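(* Let $\mathcal M^1_{K_3}$ (resp. $\mathcal M^2_{K_3}$) be the graph property of being Maker's win in the $(1:1)$ Maker-Breaker vertex $K_3$-game where Maker moves first (resp. second). For the random graph process $\tilde G$ on $n$ vertices, w.h.p. $\tau(\tilde G,\mathcal M^1_{K_3})=\tau(\tilde G,\mathcal G_{DD})$ and $\tau(\tilde G,\mathcal M^2_{K_3})=\tau(\tilde G,\mathcal G_{2DD})$.
   Context: The $(1:1)$ Maker-Breaker vertex $K_3$-game on a graph $G$: Maker and Breaker alternately claim one previously unclaimed vertex of $G$ each until all vertices are claimed; Maker wins if the subgraph of $G$ induced by his vertices contains a triangle, otherwise Breaker wins. The random graph process on $[n]$: order the $m=\binom n2$ edges of $K_n$ by a uniformly random permutation and let $G_i$ be the graph on $[n]$ with the first $i$ edges, $\tilde G=(G_i)_{i=0}^m$. For a monotone increasing property $\mathcal P$, $\tau(\tilde G,\mathcal P)=\min\{i: G_i\in\mathcal P\}$. A double diamond $DD$ is the graph on vertices $x,y_1,z_1,z_2,y_2,z_3,z_4$ with edges $xy_1,xz_1,xz_2,y_1z_1,y_1z_2,xy_2,xz_3,xz_4,y_2z_3,y_2z_4$ (two copies of $K_4$ minus an edge, sharing the single vertex $x$). For a graph $F$ and integer $k$, $\mathcal G_{kF}$ is the property of containing $k$ (possibly intersecting) copies of $F$, and $\mathcal G_F=\mathcal G_{1F}$. "W.h.p." means with probability tending to 1 as $n\to\infty$. *)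

theory Defs
  imports Complex_Main "HOL-Combinatorics.Multiset_Permutations"
begin

definition Kn_edges :: "nat \<Rightarrow> nat set set" where
  "Kn_edges n = {e. \<exists>a b. a < n \<and> b < n \<and> a \<noteq> b \<and> e = {a, b}}"

definition proc_graph :: "nat set list \<Rightarrow> nat \<Rightarrow> nat set set" where
  "proc_graph es i = set (take i es)"

definition hitting_time :: "nat set list \<Rightarrow> (nat set set \<Rightarrow> bool) \<Rightarrow> nat option" where
  "hitting_time es P =
     (if \<exists>i \<le> length es. P (proc_graph es i)
      then Some (LEAST i. P (proc_graph es i)) else None)"

definition has_triangle :: "nat set set \<Rightarrow> nat set \<Rightarrow> bool" where
  "has_triangle E M = (\<exists>a\<in>M. \<exists>b\<in>M. \<exists>c\<in>M. a \<noteq> b \<and> b \<noteq> c \<and> a \<noteq> c \<and>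
       {a, b} \<in> E \<and> {b, c} \<in> E \<and> {a, c} \<in> E)"

text \<open>Maker-Breaker vertex K3-game on vertex set V with edges E.
  mwin_M V E M B: Maker to move, can force a win from the position (M, B).
  mwin_B V E M B: Breaker to move, Maker can force a win.\<close>
inductive mwin_M :: "nat set \<Rightarrow> nat set set \<Rightarrow> nat set \<Rightarrow> nat set \<Rightarrow> bool"
  and mwin_B :: "nat set \<Rightarrow> nat set set \<Rightarrow> nat set \<Rightarrow> nat set \<Rightarrow> bool"
  for V E where
  triM: "has_triangle E M \<Longrightarrow> mwin_M V E M B"
| triB: "has_triangle E M \<Longrightarrow> mwin_B V E M B"
| moveM: "v \<in> V \<Longrightarrow> v \<notin> M \<Longrightarrow> v \<notin> B \<Longrightarrow> mwin_B V E (insert v M) B \<Longrightarrow> mwin_M V E M B"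
| moveB: "V - M - B \<noteq> {} \<Longrightarrow> (\<forall>v \<in> V - M - B. mwin_M V E M (insert v B)) \<Longrightarrow> mwin_B V E M B"

definition maker_first_win :: "nat \<Rightarrow> nat set set \<Rightarrow> bool" where
  "maker_first_win n E = mwin_M {0..<n} E {} {}"

definition maker_second_win :: "nat \<Rightarrow> nat set set \<Rightarrow> bool" where
  "maker_second_win n E = mwin_B {0..<n} E {} {}"

text \<open>Double diamond on vertices x=0, y1=1, z1=2, z2=3, y2=4, z3=5, z4=6.\<close>
definition DD_edges :: "nat set set" where
  "DD_edges = {{0,1},{0,2},{0,3},{1,2},{1,3},{0,4},{0,5},{0,6},{4,5},{4,6}}"

definition DD_copies :: "nat set set \<Rightarrow> nat set set set" where
  "DD_copies E = {(\<lambda>e. f ` e) ` DD_edges | f. inj_on f {0..<7} \<and> (\<lambda>e. f ` e) ` DD_edges \<subseteq> E}"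

definition has_k_DD :: "nat \<Rightarrow> nat set set \<Rightarrow> bool" where
  "has_k_DD k E = (card (DD_copies E) \<ge> k)"

definition proc_prob :: "nat \<Rightarrow> (nat set list \<Rightarrow> bool) \<Rightarrow> real" where
  "proc_prob n Q = real (card {es \<in> permutations_of_set (Kn_edges n). Q es})
                   / real (card (permutations_of_set (Kn_edges n)))"

end

theory Submission
  imports Defs "HOL-Library.Ramsey" "HOL-Probability.Probability_Mass_Function"
    "HOL-Real_Asymp.Real_Asymp"
begin

text \<open>
  Give a vertex set \<open>S\<close> of a graph the weight \<open>10 |S| - 7 e(S)\<close>. Slightly after the double diamond
  threshold, the first moment method shows that w.h.p. no set of at most 23 vertices has negative
  weight (the graph is locally sparse), and the second moment method that there are two double
  diamonds.

  In a locally sparse graph the theorem is deterministic. The double diamond has weight 0 and its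
  proper subgraphs have positive weight, so distinct copies are vertex-disjoint. Maker wins on a
  double diamond by taking its centre, and with two disjoint copies he can afford to move second.
  Conversely, without a double diamond the vertices can be paired off so that every triangle contains
  a pair, and Breaker wins by answering inside the pairs; if there is a unique double diamond and
  Breaker starts, he first takes one of its vertices. For the pairing, consider a minimal family of
  triangles that admits none. It is connected, and each of its triangles has at most one private
  vertex. Attaching a triangle by a vertex costs weight at least 1, by an edge at least 4, so starting
  from a triangle (weight at most 9) the family is small, and by counting it contains two triangles
  with a common edge (weight at most 5). From there, at most two further triangles fit in, and the
  only way to prevent a pairing is to form a second such diamond that completes a double diamond.
\<close>

section \<open>Pairings\<close>

definition triangles :: "'a set set \<Rightarrow> 'a set set" where
  "triangles G = {T. card T = 3 \<and> [T]\<^bsup>2\<^esup> \<subseteq> G}"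

lemma finite_triangle: "T \<in> triangles G \<Longrightarrow> finite T"
  by (auto simp: triangles_def intro: card_ge_0_finite)

lemma triangle_edge: "T \<in> triangles G \<Longrightarrow> u \<in> T \<Longrightarrow> v \<in> T \<Longrightarrow> u \<noteq> v \<Longrightarrow> {u, v} \<in> G"
  by (auto simp: triangles_def)

lemma insert3_in_triangles_iff:
  assumes "distinct [a, b, c]"
  shows "{a, b, c} \<in> triangles G \<longleftrightarrow> {a, b} \<in> G \<and> {a, c} \<in> G \<and> {b, c} \<in> G"
  using assms unfolding triangles_def nsets_2_eq by (auto simp: insert_commute)

lemma triangle_subset_Union: "T \<in> triangles G \<Longrightarrow> T \<subseteq> \<Union>G"
proof
  fix v assume T: "T \<in> triangles G" and "v \<in> T"
  then have "\<not> T \<subseteq> {v}"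
    using card_mono[of "{v}" T] by (auto simp: triangles_def)
  then obtain u where "u \<in> T" "u \<noteq> v" by blast
  then show "v \<in> \<Union>G" using triangle_edge[OF T \<open>v \<in> T\<close>, of u] by auto
qed

lemma has_triangle_iff: "has_triangle E M \<longleftrightarrow> (\<exists>T\<in>triangles E. T \<subseteq> M)"
proof
  assume "has_triangle E M"
  then obtain a b c where vertices: "a \<in> M" "b \<in> M" "c \<in> M" "a \<noteq> b" "b \<noteq> c" "a \<noteq> c"
    and "{a, b} \<in> E" "{b, c} \<in> E" "{a, c} \<in> E"
    unfolding has_triangle_def by blast
  then have "{a, b, c} \<in> triangles E" by (simp add: insert3_in_triangles_iff)
  with vertices show "\<exists>T\<in>triangles E. T \<subseteq> M" by (intro bexI[of _ "{a, b, c}"]) auto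
next
  assume "\<exists>T\<in>triangles E. T \<subseteq> M"
  then obtain T where T: "T \<in> triangles E" "T \<subseteq> M" ..
  then obtain a b c where "T = {a, b, c}" "distinct [a, b, c]"
    by (auto simp: triangles_def card_3_iff)
  with T show "has_triangle E M"
    unfolding has_triangle_def by (auto simp: insert3_in_triangles_iff)
qed

definition pairing :: "'a set set \<Rightarrow> 'a set set \<Rightarrow> bool" where
  "pairing P \<T> \<longleftrightarrow> (\<forall>p\<in>P. card p = 2) \<and> disjoint P \<and> (\<forall>T\<in>\<T>. \<exists>p\<in>P. p \<subseteq> T)"

lemma pairing_covers: "pairing P \<T> \<Longrightarrow> T \<in> \<T> \<Longrightarrow> \<exists>p\<in>P. p \<subseteq> T"
  by (simp add: pairing_def)

definition pairable :: "'a set set \<Rightarrow> bool" where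
  "pairable \<T> \<longleftrightarrow> (\<exists>P. pairing P \<T>)"

lemma pairable_empty: "pairable {}"
  unfolding pairable_def pairing_def by (intro exI[of _ "{}"]) (simp add: disjoint_def)

lemma pairableE:
  assumes "pairable \<T>"
  obtains P where "pairing P \<T>" "\<Union>P \<subseteq> \<Union>\<T>"
proof -
  obtain P where P: "pairing P \<T>" using assms unfolding pairable_def ..
  let ?Q = "{p \<in> P. \<exists>T\<in>\<T>. p \<subseteq> T}"
  have "\<exists>p\<in>?Q. p \<subseteq> T" if "T \<in> \<T>" for T
    using pairing_covers[OF P that] that by blast
  moreover have "disjoint ?Q"
    using P unfolding pairing_def by (elim conjE) (rule pairwise_subset, auto)
  ultimately have "pairing ?Q \<T>" using P by (simp add: pairing_def)
  then show thesis by (rule that) blast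
qed

lemma pairable_Un:
  assumes "pairable \<S>" "pairable \<T>" "\<Union>\<S> \<inter> \<Union>\<T> = {}"
  shows "pairable (\<S> \<union> \<T>)"
proof -
  obtain P Q where P: "pairing P \<S>" "\<Union>P \<subseteq> \<Union>\<S>" and Q: "pairing Q \<T>" "\<Union>Q \<subseteq> \<Union>\<T>"
    using assms(1,2) by (elim pairableE)
  have "\<Union>P \<inter> \<Union>Q = {}" using P(2) Q(2) assms(3) by blast
  then have "disjoint (P \<union> Q)"
    using P(1) Q(1) by (intro disjoint_union) (auto simp: pairing_def)
  then have "pairing (P \<union> Q) (\<S> \<union> \<T>)" using P(1) Q(1) by (auto simp: pairing_def bex_Un)
  then show ?thesis unfolding pairable_def ..
qed

lemma pairable_insert:
  assumes "pairable \<T>" "p \<subseteq> T" "card p = 2" "p \<inter> \<Union>\<T> = {}"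
  shows "pairable (insert T \<T>)"
proof -
  obtain P where P: "pairing P \<T>" "\<Union>P \<subseteq> \<Union>\<T>" using assms(1) by (rule pairableE)
  have "p \<inter> q = {}" if "q \<in> P" for q using that P(2) assms(4) by blast
  then have "disjoint (insert p P)"
    using P(1) by (auto simp: pairing_def pairwise_insert disjnt_def)
  then have "pairing (insert p P) (insert T \<T>)"
    using P(1) assms(2,3) by (auto simp: pairing_def)
  then show ?thesis unfolding pairable_def ..
qed

section \<open>The triangle game\<close>

text \<open>This invariant of the pairing strategy survives any move of Breaker, so he plays anywhere when
  no answer within a pair is called for.\<close>
definition breaker_safe :: "nat set set \<Rightarrow> nat set set \<Rightarrow> nat set \<Rightarrow> nat set \<Rightarrow> bool" where
  "breaker_safe E P M B \<longleftrightarrow> M \<inter> B = {} \<and>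
     (\<forall>T\<in>triangles E. T \<inter> B \<noteq> {} \<or> (\<exists>p\<in>P. p \<subseteq> T \<and> p \<inter> M = {}))"

definition breaker_has_safe_move ::
    "nat set \<Rightarrow> nat set set \<Rightarrow> nat set set \<Rightarrow> nat set \<Rightarrow> nat set \<Rightarrow> bool" where
  "breaker_has_safe_move V E P M B \<longleftrightarrow> \<not> has_triangle E M \<and>
     (V - M - B = {} \<or> (\<exists>u\<in>V - M - B. breaker_safe E P M (insert u B)))"

lemma breaker_safe_no_triangle:
  assumes safe: "breaker_safe E P M B" and pairing: "pairing P \<T>"
    and move: "M' \<subseteq> insert v M" "M' \<inter> B = {}"
  shows "\<not> has_triangle E M'"
proof
  assume "has_triangle E M'"
  then obtain T where T: "T \<in> triangles E" "T \<subseteq> M'" by (auto simp: has_triangle_iff)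
  then have "T \<inter> B = {}" using move(2) by blast
  then obtain p where p: "p \<in> P" "p \<subseteq> T" "p \<inter> M = {}"
    using safe T(1) unfolding breaker_safe_def by blast
  then have "p \<subseteq> {v}" using T(2) move(1) by blast
  then show False using p(1) pairing card_mono[of "{v}" p] by (simp add: pairing_def)
qed

lemma ex_pairing_response:
  assumes pairing: "pairing P \<T>" "\<Union>P \<subseteq> V" and free: "V - insert v M - B \<noteq> {}"
  shows "\<exists>u\<in>V - insert v M - B. \<forall>p\<in>P. v \<in> p \<longrightarrow> p \<inter> (M \<union> B) = {} \<longrightarrow> u \<in> p"
proof (cases "\<exists>p\<in>P. v \<in> p \<and> p \<inter> (M \<union> B) = {}")
  case True
  then obtain p where p: "p \<in> P" "v \<in> p" "p \<inter> (M \<union> B) = {}" by blast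
  then have "card p = 2" using pairing(1) by (simp add: pairing_def)
  then obtain u where u: "p = {v, u}" "u \<noteq> v" using p(2) by (auto simp: card_2_iff)
  have "q = p" if "q \<in> P" "v \<in> q" for q
    using pairing(1) p(1,2) that by (auto simp: pairing_def dest: disjointD)
  with p u pairing(2) show ?thesis by (intro bexI[of _ u]) auto
next
  case False
  with free show ?thesis by blast
qed

lemma breaker_safe_step:
  assumes safe: "breaker_safe E P M B" and pairing: "pairing P \<T>" "\<Union>P \<subseteq> V"
    and unclaimed: "v \<notin> M" "v \<notin> B"
  shows "breaker_has_safe_move V E P (insert v M) B"
proof -
  have disjoint: "M \<inter> B = {}" using safe by (simp add: breaker_safe_def)
  have "\<not> has_triangle E (insert v M)"
    using disjoint unclaimed(2) by (intro breaker_safe_no_triangle[OF safe pairing(1)]) auto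
  moreover have "\<exists>u\<in>V - insert v M - B. breaker_safe E P (insert v M) (insert u B)"
    if free: "V - insert v M - B \<noteq> {}"
  proof -
    obtain u where u: "u \<in> V - insert v M - B"
      and answer: "\<forall>p\<in>P. v \<in> p \<longrightarrow> p \<inter> (M \<union> B) = {} \<longrightarrow> u \<in> p"
      using ex_pairing_response[OF pairing free] by blast
    have "breaker_safe E P (insert v M) (insert u B)"
      unfolding breaker_safe_def
    proof (intro conjI ballI)
      show "insert v M \<inter> insert u B = {}" using disjoint u unclaimed by blast
      fix T assume "T \<in> triangles E"
      then consider "T \<inter> B \<noteq> {}" | p where "p \<in> P" "p \<subseteq> T" "p \<inter> M = {}" "T \<inter> B = {}"
        using safe unfolding breaker_safe_def by blast
      then show "T \<inter> insert u B \<noteq> {} \<or> (\<exists>p\<in>P. p \<subseteq> T \<and> p \<inter> insert v M = {})"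
      proof cases
        case (2 p)
        then have "p \<inter> (M \<union> B) = {}" by blast
        then have "v \<in> p \<longrightarrow> u \<in> p" using answer 2(1) by blast
        then show ?thesis using 2(1-3) by blast
      qed blast
    qed
    with u show ?thesis ..
  qed
  ultimately show ?thesis unfolding breaker_has_safe_move_def by blast
qed

lemma breaker_safe_not_mwin_M:
  assumes pairing: "pairing P \<T>" "\<Union>P \<subseteq> V"
  shows "mwin_M V E M B \<Longrightarrow> \<not> breaker_safe E P M B"
    and "mwin_B V E M B \<Longrightarrow> \<not> breaker_has_safe_move V E P M B"
proof (induction rule: mwin_M_mwin_B.inducts)
  case (triM M B)
  then show ?case
    using breaker_safe_no_triangle[OF _ pairing(1) subset_insertI, of E M B]
    unfolding breaker_safe_def by blast
next
  case (triB M B)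
  then show ?case by (simp add: breaker_has_safe_move_def)
next
  case (moveM v M B)
  then show ?case using breaker_safe_step[OF _ pairing \<open>v \<notin> M\<close> \<open>v \<notin> B\<close>] by blast
next
  case (moveB M B)
  then show ?case by (auto simp: breaker_has_safe_move_def)
qed

lemma pairable_not_mwin_M:
  assumes "pairable (triangles {e \<in> E. e \<inter> B = {}})" "\<Union>E \<subseteq> V"
  shows "\<not> mwin_M V E {} B"
proof -
  let ?G = "{e \<in> E. e \<inter> B = {}}"
  obtain P where P: "pairing P (triangles ?G)" "\<Union>P \<subseteq> \<Union>(triangles ?G)"
    using assms(1) by (rule pairableE)
  have "\<Union>(triangles ?G) \<subseteq> \<Union>?G" using triangle_subset_Union by blast
  also have "\<dots> \<subseteq> V" using assms(2) by blast
  finally have P_subset: "\<Union>P \<subseteq> V" using P(2) by blast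
  have "T \<in> triangles ?G" if "T \<in> triangles E" "T \<inter> B = {}" for T
    using that by (auto simp: triangles_def nsets_def)
  then have "breaker_safe E P {} B"
    using pairing_covers[OF P(1)] by (auto simp: breaker_safe_def)
  then show ?thesis using breaker_safe_not_mwin_M(1)[OF P(1) P_subset] by blast
qed

lemma mwin_B_iff_all_moves:
  assumes "V - M - B \<noteq> {}" "\<not> has_triangle E M"
  shows "mwin_B V E M B \<longleftrightarrow> (\<forall>v\<in>V - M - B. mwin_M V E M (insert v B))"
proof
  assume "mwin_B V E M B"
  then show "\<forall>v\<in>V - M - B. mwin_M V E M (insert v B)"
    using assms(2) by (cases rule: mwin_B.cases) simp_all
next
  assume "\<forall>v\<in>V - M - B. mwin_M V E M (insert v B)"
  with assms(1) show "mwin_B V E M B" by (rule moveB)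
qed

lemma mwin_M_diamond:
  assumes centre: "x \<in> M" and free: "{y, z1, z2} \<subseteq> V - M - B" and distinct: "distinct [y, z1, z2]"
    and edges: "{{x, y}, {x, z1}, {x, z2}, {y, z1}, {y, z2}} \<subseteq> E"
  shows "mwin_M V E M B"
proof (rule moveM)
  show "mwin_B V E (insert y M) B"
  proof (rule moveB)
    show "V - insert y M - B \<noteq> {}" using free distinct by auto
    show "\<forall>v\<in>V - insert y M - B. mwin_M V E (insert y M) (insert v B)"
    proof
      fix v
      obtain z where z: "z \<in> {z1, z2}" "z \<noteq> v" using distinct by (cases "v = z1") auto
      then have "has_triangle E (insert z (insert y M))"
        unfolding has_triangle_def using centre free distinct edges
        by (intro bexI[of _ x] bexI[of _ y] bexI[of _ z]) auto
      then show "mwin_M V E (insert y M) (insert v B)"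
        using z free distinct by (intro moveM[of z]) (auto intro: triB)
    qed
  qed
qed (use free in auto)

lemma mwin_B_two_diamonds:
  assumes centre: "x \<in> M"
    and free: "{y1, z1, z2} \<subseteq> V - M - B" "{y2, z3, z4} \<subseteq> V - M - B"
    and disjoint: "{y1, z1, z2} \<inter> {y2, z3, z4} = {}"
    and distinct: "distinct [y1, z1, z2]" "distinct [y2, z3, z4]"
    and edges: "{{x, y1}, {x, z1}, {x, z2}, {y1, z1}, {y1, z2}} \<subseteq> E"
      "{{x, y2}, {x, z3}, {x, z4}, {y2, z3}, {y2, z4}} \<subseteq> E"
  shows "mwin_B V E M B"
proof (rule moveB)
  show "V - M - B \<noteq> {}" using free by auto
  show "\<forall>v\<in>V - M - B. mwin_M V E M (insert v B)"
  proof
    fix v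
    show "mwin_M V E M (insert v B)"
    proof (cases "v \<in> {y1, z1, z2}")
      case True
      then have "{y2, z3, z4} \<subseteq> V - M - insert v B" using free(2) disjoint by blast
      then show ?thesis using distinct(2) edges(2) by (rule mwin_M_diamond[OF centre])
    next
      case False
      then have "{y1, z1, z2} \<subseteq> V - M - insert v B" using free(1) by blast
      then show ?thesis using distinct(1) edges(1) by (rule mwin_M_diamond[OF centre])
    qed
  qed
qed

section \<open>Sparse graphs\<close>

definition induced_edges :: "'a set set \<Rightarrow> 'a set \<Rightarrow> 'a set set" where
  "induced_edges G S = {e \<in> G. e \<subseteq> S}"

lemma finite_induced_edges: "finite G \<Longrightarrow> finite (induced_edges G S)"
  by (simp add: induced_edges_def)

definition weight :: "'a set set \<Rightarrow> 'a set \<Rightarrow> int" where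
  "weight G S = 10 * int (card S) - 7 * int (card (induced_edges G S))"

text \<open>The bound 23: \<open>card S + 2 * weight G S\<close> is at most 21 for a triangle and does not increase when
  a triangle is attached to \<open>S\<close>, so \<open>S\<close> has at most 21 vertices as long as its weight is nonnegative,
  and one more triangle adds at most 2.\<close>
definition locally_sparse :: "'a set set \<Rightarrow> bool" where
  "locally_sparse G \<longleftrightarrow> (\<forall>S. finite S \<and> card S \<le> 23 \<longrightarrow> 0 \<le> weight G S)"

lemma locally_sparseD: "locally_sparse G \<Longrightarrow> finite S \<Longrightarrow> card S \<le> 23 \<Longrightarrow> 0 \<le> weight G S"
  by (simp add: locally_sparse_def)

lemma locally_sparse_subset:
  assumes "locally_sparse H" "G \<subseteq> H" "finite H"
  shows "locally_sparse G"
  unfolding locally_sparse_def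
proof (intro allI impI, elim conjE)
  fix S :: "'a set" assume "finite S" "card S \<le> 23"
  moreover have "card (induced_edges G S) \<le> card (induced_edges H S)"
    using assms by (intro card_mono finite_induced_edges) (auto simp: induced_edges_def)
  ultimately show "0 \<le> weight G S"
    using locally_sparseD[OF assms(1), of S] by (simp add: weight_def)
qed

lemma weight_Un_le:
  assumes "finite G" "F \<subseteq> G" "\<And>e. e \<in> F \<Longrightarrow> e \<subseteq> S \<union> T \<and> \<not> e \<subseteq> S" "finite S" "finite T"
  shows "weight G (S \<union> T) \<le> weight G S + 10 * int (card (T - S)) - 7 * int (card F)"
proof -
  have "finite F" using assms(1,2) finite_subset by blast
  then have "card (induced_edges G S) + card F = card (induced_edges G S \<union> F)"
    using assms(1,3) finite_induced_edges
    by (intro card_Un_disjoint[symmetric]) (auto simp: induced_edges_def)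
  also have "\<dots> \<le> card (induced_edges G (S \<union> T))"
    using assms(1-3) by (intro card_mono finite_induced_edges) (auto simp: induced_edges_def)
  finally show ?thesis
    using assms(4,5) card_Un_disjoint[of S "T - S"] by (simp add: weight_def)
qed

lemma weight_triangle_le:
  assumes "finite G" "T \<in> triangles G"
  shows "weight G T \<le> 9"
proof -
  have T: "card T = 3" "[T]\<^bsup>2\<^esup> \<subseteq> G" using assms(2) by (auto simp: triangles_def)
  then have "card ([T]\<^bsup>2\<^esup>) \<le> card (induced_edges G T)"
    using assms(1)
    by (intro card_mono finite_induced_edges) (auto simp: induced_edges_def nsets_def)
  with T(1) show ?thesis by (simp add: weight_def choose_two)
qed

lemma weight_attach_le:
  assumes "finite G" "finite S" "T \<in> triangles G"
    and extra: "X \<subseteq> G" "\<And>e. e \<in> X \<Longrightarrow> e \<subseteq> S \<union> T \<and> \<not> e \<subseteq> S \<and> \<not> e \<subseteq> T"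
  shows "card (T \<inter> S) = 1 \<Longrightarrow> weight G (S \<union> T) \<le> weight G S - 1 - 7 * int (card X)"
    and "card (T \<inter> S) = 2 \<Longrightarrow> weight G (S \<union> T) \<le> weight G S - 4 - 7 * int (card X)"
proof -
  let ?F = "[T]\<^bsup>2\<^esup> - Pow S"
  have T: "card T = 3" "[T]\<^bsup>2\<^esup> \<subseteq> G" "finite T"
    using assms(3) finite_triangle by (auto simp: triangles_def)
  have "[T]\<^bsup>2\<^esup> \<inter> Pow S = [T \<inter> S]\<^bsup>2\<^esup>" by (auto simp: nsets_def)
  then have card_F: "card ?F = 3 - (card (T \<inter> S) choose 2)"
    using T by (simp add: card_Diff_subset_Int finite_imp_finite_nsets choose_two)
  have "card (?F \<union> X) = card ?F + card X"
    using extra T(3) finite_subset[OF extra(1) assms(1)]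
    by (intro card_Un_disjoint) (auto simp: finite_imp_finite_nsets nsets_def)
  moreover have "weight G (S \<union> T) \<le> weight G S + 10 * int (card (T - S)) - 7 * int (card (?F \<union> X))"
    using assms T by (intro weight_Un_le) (auto simp: nsets_def)
  moreover have "card (T - S) = 3 - card (T \<inter> S)"
    using T by (simp add: card_Diff_subset_Int)
  ultimately show "card (T \<inter> S) = 1 \<Longrightarrow> weight G (S \<union> T) \<le> weight G S - 1 - 7 * int (card X)"
    and "card (T \<inter> S) = 2 \<Longrightarrow> weight G (S \<union> T) \<le> weight G S - 4 - 7 * int (card X)"
    using card_F by (simp_all add: choose_two)
qed

lemma card_attached_Int:
  assumes "card T = 3" "T \<inter> S \<noteq> {}" "\<not> T \<subseteq> S"
  shows "card (T \<inter> S) = 1 \<or> card (T \<inter> S) = 2"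
proof -
  have "finite T" using assms(1) by (auto intro: card_ge_0_finite)
  moreover from this have "card (T \<inter> S) < card T" using assms(3) by (intro psubset_card_mono) auto
  moreover have "card (T \<inter> S) \<noteq> 0" using assms(2) \<open>finite T\<close> by simp
  ultimately show ?thesis using assms(1) by linarith
qed

lemma weight_attach_two_le:
  assumes "finite G" "finite S" and T: "T \<in> triangles G"
    and T': "T' \<in> triangles G" "T' \<subseteq> S \<union> T" "\<not> T' \<subseteq> S" "T' \<noteq> T"
  shows "card (T \<inter> S) = 1 \<Longrightarrow> weight G (S \<union> T) \<le> weight G S - 8"
    and "card (T \<inter> S) = 2 \<Longrightarrow> weight G (S \<union> T) \<le> weight G S - 11"
proof -
  obtain w where w: "w \<in> T'" "w \<notin> S" using T'(3) by blast
  have "\<not> T' \<subseteq> T"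
    using T T' finite_triangle[OF T] card_subset_eq[of T T'] by (auto simp: triangles_def)
  then obtain a where a: "a \<in> T'" "a \<notin> T" by blast
  have "{w, a} \<in> G" using triangle_edge[OF T'(1)] w a T'(2) by blast
  then have extra: "{{w, a}} \<subseteq> G" "\<And>e. e \<in> {{w, a}} \<Longrightarrow> e \<subseteq> S \<union> T \<and> \<not> e \<subseteq> S \<and> \<not> e \<subseteq> T"
    using w a T'(2) by auto
  show "card (T \<inter> S) = 1 \<Longrightarrow> weight G (S \<union> T) \<le> weight G S - 8"
    using weight_attach_le(1)[OF assms(1,2) T extra] by simp
  show "card (T \<inter> S) = 2 \<Longrightarrow> weight G (S \<union> T) \<le> weight G S - 11"
    using weight_attach_le(2)[OF assms(1,2) T extra] by simp
qed

inductive grown :: "'a set set \<Rightarrow> 'a set \<Rightarrow> 'a set \<Rightarrow> bool" for \<T> A where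
  start: "grown \<T> A A"
| attach: "grown \<T> A S \<Longrightarrow> T \<in> \<T> \<Longrightarrow> T \<inter> S \<noteq> {} \<Longrightarrow> \<not> T \<subseteq> S \<Longrightarrow> grown \<T> A (S \<union> T)"

lemma grown_bounds:
  assumes "grown \<T> A S" and graph: "finite G" "locally_sparse G" "\<T> \<subseteq> triangles G"
    and base: "finite A" "int (card A) + 2 * weight G A \<le> 21" "card A \<le> 23"
  shows "finite S \<and> 0 \<le> weight G S \<and> int (card S) + 2 * weight G S \<le> 21"
  using assms(1)
proof (induction rule: grown.induct)
  case start
  then show ?case using base locally_sparseD[OF graph(2)] by auto
next
  case (attach S T)
  have T: "T \<in> triangles G" "card T = 3" "finite T"
    using attach.hyps(2) graph(3) finite_triangle by (auto simp: triangles_def)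
  have card: "card (S \<union> T) + card (T \<inter> S) = card S + 3"
    using card_Un_Int[of S T] attach.IH T by (simp add: Int_commute)
  have "card (T \<inter> S) = 1 \<or> card (T \<inter> S) = 2"
    using T(2) attach.hyps(3,4) by (rule card_attached_Int)
  then have "int (card (S \<union> T)) + 2 * weight G (S \<union> T) \<le> 21"
    using card attach.IH weight_attach_le[of G S T "{}"] graph(1) T(1) by auto
  moreover have "0 \<le> weight G (S \<union> T)"
    using card attach.IH T(3) \<open>card (T \<inter> S) = 1 \<or> card (T \<inter> S) = 2\<close>
    by (intro locally_sparseD[OF graph(2)]) auto
  ultimately show ?case using attach.IH T(3) by simp
qed

section \<open>Minimal families of triangles without a pairing\<close>

locale minimal_unpairable =
  fixes G :: "'a set set" and \<T> :: "'a set set"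
  assumes finite_G: "finite G" and sparse_G: "locally_sparse G" and triangles: "\<T> \<subseteq> triangles G"
    and not_pairable: "\<not> pairable \<T>"
    and minimal: "\<And>\<S>. \<S> \<subset> \<T> \<Longrightarrow> pairable \<S>"
begin

abbreviation V :: "'a set" where
  "V \<equiv> \<Union>\<T>"

lemma card_triangle: "T \<in> \<T> \<Longrightarrow> card T = 3" and finite_member: "T \<in> \<T> \<Longrightarrow> finite T"
  using triangles finite_triangle by (auto simp: triangles_def)

lemma nonempty: "\<T> \<noteq> {}"
  using pairable_empty not_pairable by metis

lemma ex_triangle_avoiding_pairs:
  assumes "disjoint P" "\<forall>p\<in>P. card p = 2"
  shows "\<exists>T\<in>\<T>. \<forall>p\<in>P. \<not> p \<subseteq> T"
proof (rule ccontr)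
  assume "\<not> ?thesis"
  then have "pairing P \<T>" using assms by (simp add: pairing_def)
  then show False using not_pairable unfolding pairable_def by blast
qed

lemma connected:
  assumes "S \<inter> V \<noteq> {}" "\<not> V \<subseteq> S"
  shows "\<exists>T\<in>\<T>. T \<inter> S \<noteq> {} \<and> \<not> T \<subseteq> S"
proof (rule ccontr)
  assume split: "\<not> ?thesis"
  let ?outside = "{T \<in> \<T>. T \<inter> S = {}}" and ?inside = "{T \<in> \<T>. T \<subseteq> S}"
  have "?outside \<subset> \<T>" "?inside \<subset> \<T>" using assms by blast+
  then have "pairable (?outside \<union> ?inside)"
    by (intro pairable_Un minimal) blast+
  moreover have "?outside \<union> ?inside = \<T>" using split by blast
  ultimately show False using not_pairable by metis
qed

lemma at_most_one_private:
  assumes T: "T \<in> \<T>" and p: "p \<subseteq> T" "card p = 2"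
  shows "\<exists>T'\<in>\<T>. T' \<noteq> T \<and> p \<inter> T' \<noteq> {}"
proof (rule ccontr)
  assume isolated: "\<not> ?thesis"
  have "pairable (\<T> - {T})" using T by (intro minimal) blast
  then have "pairable (insert T (\<T> - {T}))"
    using p isolated by (intro pairable_insert) auto
  then show False using T not_pairable by (simp add: insert_absorb)
qed

lemma grown_V:
  assumes base: "A \<subseteq> V" "A \<noteq> {}" "finite A" "int (card A) + 2 * weight G A \<le> 21" "card A \<le> 23"
  shows "grown \<T> A V"
proof -
  note bounds = grown_bounds[OF _ finite_G sparse_G triangles base(3-5)]
  have "\<forall>S. grown \<T> A S \<longrightarrow> card S < 22" using bounds by force
  then obtain S where S: "grown \<T> A S" "\<And>S'. grown \<T> A S' \<Longrightarrow> card S' \<le> card S"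
    using ex_has_greatest_nat[of "grown \<T> A" A card 22] grown.start by metis
  have "A \<subseteq> S \<and> S \<subseteq> V" using S(1) base(1) by induction auto
  moreover have "V \<subseteq> S"
  proof (rule ccontr)
    assume "\<not> V \<subseteq> S"
    moreover have "S \<inter> V \<noteq> {}" using \<open>A \<subseteq> S \<and> S \<subseteq> V\<close> base(2) by blast
    ultimately obtain T where T: "T \<in> \<T>" "T \<inter> S \<noteq> {}" "\<not> T \<subseteq> S" using connected by blast
    then have "grown \<T> A (S \<union> T)" using S(1) by (intro grown.attach)
    moreover from this have "card S < card (S \<union> T)"
      using bounds T(3) by (intro psubset_card_mono) auto
    ultimately show False using S(2) by (meson not_le)
  qed
  ultimately show ?thesis using S(1) by (metis subset_antisym)
qed

lemma finite_V: "finite V" and weight_V_nonneg: "0 \<le> weight G V"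
proof -
  obtain T where T: "T \<in> \<T>" using nonempty by blast
  have triangle: "card T = 3" "finite T" "weight G T \<le> 9"
    using T card_triangle finite_member triangles weight_triangle_le[OF finite_G] by auto
  then have "grown \<T> T V" using T by (intro grown_V) auto
  then have "finite V \<and> 0 \<le> weight G V"
    using grown_bounds[OF _ finite_G sparse_G triangles, of T V] triangle by auto
  then show "finite V" "0 \<le> weight G V" by auto
qed

lemma finite_family: "finite \<T>"
  using finite_V by (rule finite_UnionD)

definition degree :: "'a \<Rightarrow> nat" where
  "degree v = card {T \<in> \<T>. v \<in> T}"

lemma card_degree_one_le_1:
  assumes T: "T \<in> \<T>"
  shows "card {v \<in> T. degree v = 1} \<le> 1"
proof (rule ccontr)
  assume "\<not> ?thesis"
  then have "2 \<le> card {v \<in> T. degree v = 1}" by linarith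
  then obtain p where p: "p \<subseteq> {v \<in> T. degree v = 1}" "card p = 2"
    by (rule obtain_subset_with_card_n)
  then obtain T' v where T': "T' \<in> \<T>" "T' \<noteq> T" "v \<in> p" "v \<in> T'"
    using at_most_one_private[OF T, of p] by auto
  have "v \<in> T" using p(1) T'(3) by blast
  then have "card {T, T'} \<le> degree v"
    unfolding degree_def using T T' finite_family by (intro card_mono) auto
  then show False using p(1) T'(2,3) by auto
qed

lemma card_degree_one_le: "card {v \<in> V. degree v = 1} \<le> card \<T>"
proof -
  have "{v \<in> V. degree v = 1} = (\<Union>T\<in>\<T>. {v \<in> T. degree v = 1})" by auto
  then have "card {v \<in> V. degree v = 1} \<le> (\<Sum>T\<in>\<T>. card {v \<in> T. degree v = 1})"
    using card_UN_le[OF finite_family, of "\<lambda>T. {v \<in> T. degree v = 1}"] by simp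
  also have "\<dots> \<le> card \<T>"
    using sum_bounded_above[of \<T> "\<lambda>T. card {v \<in> T. degree v = 1}" 1] card_degree_one_le_1 by simp
  finally show ?thesis .
qed

lemma sum_degree: "(\<Sum>v\<in>V. degree v) = 3 * card \<T>"
proof -
  have "(\<Sum>v\<in>V. degree v) = (\<Sum>T\<in>\<T>. card {v \<in> V. v \<in> T})"
    unfolding degree_def using finite_V finite_family by (intro sum_multicount_gen) auto
  also have "\<dots> = (\<Sum>T\<in>\<T>. 3)"
  proof (rule sum.cong[OF refl])
    fix T assume T: "T \<in> \<T>"
    then have "{v \<in> V. v \<in> T} = T" by blast
    then show "card {v \<in> V. v \<in> T} = 3" using card_triangle[OF T] by simp
  qed
  finally show ?thesis by simp
qed

lemma card_V_le: "card V \<le> 2 * card \<T>"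
proof -
  have "2 * card V = (\<Sum>v\<in>V. 2)" by simp
  also have "\<dots> \<le> (\<Sum>v\<in>V. degree v + (if degree v = 1 then 1 else 0))"
  proof (rule sum_mono)
    fix v assume "v \<in> V"
    then have "degree v \<noteq> 0" using finite_family by (auto simp: degree_def)
    then show "2 \<le> degree v + (if degree v = 1 then 1 else 0)" by auto
  qed
  also have "\<dots> = 3 * card \<T> + card {v \<in> V. degree v = 1}"
    using finite_V by (simp add: sum.distrib sum.If_cases Int_def flip: sum_degree)
  finally show ?thesis using card_degree_one_le by simp
qed

lemma edge_disjoint_card_edges_ge:
  assumes "\<And>T T'. T \<in> \<T> \<Longrightarrow> T' \<in> \<T> \<Longrightarrow> T \<noteq> T' \<Longrightarrow> [T]\<^bsup>2\<^esup> \<inter> [T']\<^bsup>2\<^esup> = {}"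
  shows "3 * card \<T> \<le> card (induced_edges G V)"
proof -
  have "card (\<Union>T\<in>\<T>. [T]\<^bsup>2\<^esup>) = (\<Sum>T\<in>\<T>. card ([T]\<^bsup>2\<^esup>))"
    using finite_family finite_member assms
    by (intro card_UN_disjoint) (auto intro: finite_imp_finite_nsets)
  also have "\<dots> = 3 * card \<T>"
    using card_triangle by (simp add: choose_two)
  finally have "3 * card \<T> = card (\<Union>T\<in>\<T>. [T]\<^bsup>2\<^esup>)" ..
  also have "\<dots> \<le> card (induced_edges G V)"
    using triangles finite_G
    by (intro card_mono finite_induced_edges) (auto simp: induced_edges_def triangles_def nsets_def)
  finally show ?thesis .
qed

lemma ex_diamond:
  obtains x y z1 z2 where "{x, y, z1} \<in> \<T>" "{x, y, z2} \<in> \<T>" "distinct [x, y, z1, z2]"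
proof -
  obtain T T' e where TT': "T \<in> \<T>" "T' \<in> \<T>" "T \<noteq> T'" and e: "e \<in> [T]\<^bsup>2\<^esup>" "e \<in> [T']\<^bsup>2\<^esup>"
  proof (rule ccontr)
    assume "\<not> thesis"
    then have "3 * card \<T> \<le> card (induced_edges G V)"
      using that by (intro edge_disjoint_card_edges_ge) blast
    with card_V_le weight_V_nonneg have "card \<T> = 0" by (simp add: weight_def)
    then show False using nonempty finite_family by simp
  qed
  obtain x y where xy: "e = {x, y}" "x \<noteq> y" using e(1) by (auto elim: nsets2_E)
  have third: "\<exists>z. S = {x, y, z} \<and> z \<notin> {x, y}" if "S \<in> \<T>" "e \<in> [S]\<^bsup>2\<^esup>" for S
  proof -
    have "card (S - {x, y}) = 1"
      using that xy card_triangle by (subst card_Diff_subset) auto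
    then obtain z where "S - {x, y} = {z}" by (auto simp: card_1_singleton_iff)
    then show ?thesis using that(2) xy by auto
  qed
  obtain z1 z2 where "T = {x, y, z1}" "T' = {x, y, z2}" "z1 \<notin> {x, y}" "z2 \<notin> {x, y}"
    using third[OF TT'(1) e(1)] third[OF TT'(2) e(2)] by blast
  with TT' xy(2) show thesis by (intro that[of x y z1 z2]) auto
qed

end

locale minimal_unpairable_diamond = minimal_unpairable +
  fixes x y z1 z2 :: 'a
  assumes diamond_triangles: "{x, y, z1} \<in> \<T>" "{x, y, z2} \<in> \<T>"
    and diamond_distinct: "distinct [x, y, z1, z2]"
begin

definition D :: "'a set" where
  "D = {x, y, z1, z2}"

lemma D_eq: "D = {x, y, z1} \<union> {x, y, z2}"
  by (auto simp: D_def)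

lemma card_D: "card D = 4"
  using diamond_distinct by (simp add: D_def)

lemma weight_D_le: "weight G D \<le> 5"
proof -
  have "{x, y, z2} \<inter> {x, y, z1} = {x, y}" using diamond_distinct by auto
  then have "card ({x, y, z2} \<inter> {x, y, z1}) = 2" using diamond_distinct by simp
  moreover have "{x, y, z1} \<in> triangles G" "{x, y, z2} \<in> triangles G"
    using diamond_triangles triangles by auto
  ultimately show ?thesis
    using weight_attach_le(2)[OF finite_G, of "{x, y, z1}" "{x, y, z2}" "{}"]
      weight_triangle_le[OF finite_G, of "{x, y, z1}"] by (auto simp: D_eq)
qed

lemma spine_subset:
  assumes "T \<in> \<T>" "T \<subseteq> D"
  shows "{x, y} \<subseteq> T"
proof (rule ccontr)
  assume "\<not> {x, y} \<subseteq> T"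
  then have neither: "T \<noteq> {x, y, z1}" "T \<noteq> {x, y, z2}" by auto
  have all_triangles: "{x, y, z1} \<in> triangles G" "{x, y, z2} \<in> triangles G" "T \<in> triangles G"
    using assms(1) diamond_triangles triangles by auto
  have "\<not> T \<subseteq> {x, y, z1}"
    using neither(1) card_triangle[OF assms(1)] card_triangle[OF diamond_triangles(1)]
      card_subset_eq[of "{x, y, z1}" T] by auto
  moreover have "{x, y, z2} \<inter> {x, y, z1} = {x, y}" using diamond_distinct by auto
  ultimately have "weight G D \<le> weight G {x, y, z1} - 11"
    unfolding D_eq using all_triangles neither(2) assms(2)[unfolded D_eq] diamond_distinct
    by (intro weight_attach_two_le(2)[OF finite_G, where T' = T]) simp_all
  also have "\<dots> < 0" using weight_triangle_le[OF finite_G all_triangles(1)] by simp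
  finally show False using locally_sparseD[OF sparse_G, of D] card_D by (simp add: D_def)
qed

lemma grown_D_bounds:
  assumes "grown \<T> D S"
  shows "finite S" "0 \<le> weight G S" "weight G S \<le> 5" "S \<noteq> D \<Longrightarrow> weight G S \<le> 4"
proof -
  have base: "finite D" "int (card D) + 2 * weight G D \<le> 21" "card D \<le> 23"
    using card_D weight_D_le by (auto simp: D_def)
  note bounds = grown_bounds[OF _ finite_G sparse_G triangles base]
  then show "finite S" "0 \<le> weight G S" using assms by auto
  have "weight G S \<le> 5 \<and> (S \<noteq> D \<longrightarrow> weight G S \<le> 4)"
    using assms
  proof induction
    case start
    then show ?case using weight_D_le by simp
  next
    case (attach S T)
    have "card (T \<inter> S) = 1 \<or> card (T \<inter> S) = 2"
      using card_triangle attach.hyps by (intro card_attached_Int)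
    moreover have "finite S" using bounds[OF attach.hyps(1)] by blast
    moreover have "T \<in> triangles G" using attach.hyps(2) triangles by blast
    ultimately have "weight G (S \<union> T) \<le> weight G S - 1"
      using weight_attach_le[OF finite_G, of S T "{}"] by auto
    then show ?case using attach.IH by simp
  qed
  then show "weight G S \<le> 5" "S \<noteq> D \<Longrightarrow> weight G S \<le> 4" by auto
qed

lemma grown_D_V: "grown \<T> D V"
proof (rule grown_V)
  show "D \<subseteq> V" using diamond_triangles unfolding D_eq by blast
qed (use card_D weight_D_le in \<open>auto simp: D_def\<close>)

lemma attached_unique:
  assumes S: "grown \<T> D S" and T: "T \<in> \<T>" "T \<inter> S \<noteq> {}" "\<not> T \<subseteq> S"
    and T': "T' \<in> \<T>" "T' \<subseteq> S \<union> T" "\<not> T' \<subseteq> S"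
  shows "T' = T"
proof (rule ccontr)
  assume "T' \<noteq> T"
  moreover have "card (T \<inter> S) = 1 \<or> card (T \<inter> S) = 2"
    using card_triangle[OF T(1)] T(2,3) by (rule card_attached_Int)
  ultimately have "weight G (S \<union> T) \<le> weight G S - 8"
    using weight_attach_two_le[OF finite_G grown_D_bounds(1)[OF S] subsetD[OF triangles T(1)]
        subsetD[OF triangles T'(1)] T'(2,3)] by auto
  moreover have "grown \<T> D (S \<union> T)" using S T by (rule grown.attach)
  ultimately show False using grown_D_bounds(2,3) S by fastforce
qed

lemma ex_off_spine: "\<exists>T\<in>\<T>. \<not> {x, y} \<subseteq> T"
  using ex_triangle_avoiding_pairs[of "{{x, y}}"] diamond_distinct by simp

lemma ex_off_spine_avoiding:
  assumes "q \<inter> {x, y} = {}" "card q = 2"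
  shows "\<exists>T\<in>\<T>. \<not> {x, y} \<subseteq> T \<and> \<not> q \<subseteq> T"
proof -
  have "disjoint {{x, y}, q}" using assms(1) by (auto simp: pairwise_insert disjnt_def)
  moreover have "\<forall>p\<in>{{x, y}, q}. card p = 2" using assms(2) diamond_distinct by simp
  ultimately show ?thesis using ex_triangle_avoiding_pairs[of "{{x, y}, q}"] by simp
qed

lemma last_attached:
  obtains S T where "grown \<T> D S" "T \<in> \<T>" "card (T \<inter> S) = 2" "4 \<le> weight G S"
    "\<And>T'. T' \<in> \<T> \<Longrightarrow> T' \<noteq> T \<Longrightarrow> T' \<subseteq> S"
  using grown_D_V
proof cases
  case start
  then show thesis using ex_off_spine spine_subset by (metis Union_upper)
next
  case (attach S T)
  have others: "T' \<subseteq> S" if "T' \<in> \<T>" "T' \<noteq> T" for T'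
    using attached_unique[OF attach(2-5), of T'] that attach(1) by blast
  have two: "card (T \<inter> S) = 2"
  proof (rule ccontr)
    assume "card (T \<inter> S) \<noteq> 2"
    then have "card (T - S) = 2"
      using card_attached_Int[OF card_triangle attach(4,5)] attach(3)
      by (simp add: card_Diff_subset_Int card_triangle finite_member)
    then obtain T' where "T' \<in> \<T>" "T' \<noteq> T" "(T - S) \<inter> T' \<noteq> {}"
      using at_most_one_private[OF attach(3), of "T - S"] by blast
    then show False using others by blast
  qed
  have "0 \<le> weight G S - 4"
    using weight_attach_le(2)[OF finite_G grown_D_bounds(1)[OF attach(2)], of T "{}"]
      two attach(1,3) triangles weight_V_nonneg by auto
  then show thesis using that[OF attach(2,3) two _ others] by simp
qed

lemma ex_two_off_spine: "\<exists>T1\<in>\<T>. \<exists>T2\<in>\<T>. T1 \<noteq> T2 \<and> \<not> {x, y} \<subseteq> T1 \<and> \<not> {x, y} \<subseteq> T2"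
proof -
  obtain T1 where T1: "T1 \<in> \<T>" "\<not> {x, y} \<subseteq> T1" using ex_off_spine by blast
  then have "card (T1 \<inter> {x, y}) < card {x, y}" by (intro psubset_card_mono) auto
  then have "2 \<le> card (T1 - {x, y})"
    using card_triangle[OF T1(1)] diamond_distinct by (simp add: card_Diff_subset_Int)
  then obtain q where q: "q \<subseteq> T1 - {x, y}" "card q = 2"
    by (rule obtain_subset_with_card_n)
  then obtain T2 where "T2 \<in> \<T>" "\<not> {x, y} \<subseteq> T2" "\<not> q \<subseteq> T2"
    using ex_off_spine_avoiding[of q] by blast
  moreover from this q(1) have "T1 \<noteq> T2" by blast
  ultimately show ?thesis using T1 by blast
qed

text \<open>The last triangle attached has at most one private vertex, so it costs at least 4 of the weight
  of at most 5. All previous ones cost 1 each, hence there is at most one.\<close>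
lemma two_more_triangles:
  obtains T1 T2 where "T1 \<in> \<T>" "T2 \<in> \<T>" "card (T1 \<inter> D) = 1" "card (T2 \<inter> (D \<union> T1)) = 2"
    "\<And>T. T \<in> \<T> \<Longrightarrow> T = T1 \<or> T = T2 \<or> T \<subseteq> D"
proof -
  obtain S T2 where S: "grown \<T> D S" "4 \<le> weight G S"
    and T2: "T2 \<in> \<T>" "card (T2 \<inter> S) = 2" "\<And>T. T \<in> \<T> \<Longrightarrow> T \<noteq> T2 \<Longrightarrow> T \<subseteq> S"
    using last_attached by metis
  from S(1) show thesis
  proof cases
    case start
    then have "T = T2" if "T \<in> \<T>" "\<not> {x, y} \<subseteq> T" for T
      using T2(3) spine_subset that by blast
    then show thesis using ex_two_off_spine by blast
  next
    case (attach S' T1)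
    note T1 = card_triangle[OF attach(3)] subsetD[OF triangles attach(3)]
    have "card (T1 \<inter> S') = 1 \<or> card (T1 \<inter> S') = 2"
      using T1(1) attach(4,5) by (rule card_attached_Int)
    then have one: "card (T1 \<inter> S') = 1" and "5 \<le> weight G S'"
      using weight_attach_le[OF finite_G grown_D_bounds(1)[OF attach(2)] T1(2), of "{}"]
        grown_D_bounds(3)[OF attach(2)] S(2) attach(1) by auto
    moreover from this have "S' = D" using grown_D_bounds(4)[OF attach(2)] by force
    moreover have "T = T1 \<or> T = T2 \<or> T \<subseteq> S'" if "T \<in> \<T>" for T
      using attached_unique[OF attach(2-5) that] T2(3)[OF that] attach(1) by blast
    ultimately show thesis using that[of T1 T2] attach(1,3) T2(1,2) by blast
  qed
qed

lemma neighbour_of_pendant: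
  assumes T: "T \<in> \<T>" "card (T \<inter> D) = 1" and a: "a \<in> T" "a \<notin> D" and s: "s \<in> D" "{a, s} \<in> G"
  shows "s \<in> T"
proof (rule ccontr)
  assume "s \<notin> T"
  then have "weight G (D \<union> T) \<le> weight G D - 1 - 7 * int (card {{a, s}})"
    using T triangles a s by (intro weight_attach_le(1)[OF finite_G]) (auto simp: D_def)
  moreover have "0 \<le> weight G (D \<union> T)"
    using card_Un_le[of D T] card_D card_triangle[OF T(1)] finite_member[OF T(1)]
    by (intro locally_sparseD[OF sparse_G]) (auto simp: D_def)
  ultimately show False using weight_D_le by simp
qed

lemma attachments_share_edge:
  obtains T1 T2 a s where "T1 \<in> \<T>" "T2 \<in> \<T>" "card (T1 \<inter> D) = 1" "T2 \<inter> (D \<union> T1) = {a, s}"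
    "{a, s} \<subseteq> T1" "a \<notin> D" "s \<in> {x, y}"
proof -
  obtain T1 T2 where T1: "T1 \<in> \<T>" "card (T1 \<inter> D) = 1"
    and T2: "T2 \<in> \<T>" "card (T2 \<inter> (D \<union> T1)) = 2"
    and family: "\<And>T. T \<in> \<T> \<Longrightarrow> T = T1 \<or> T = T2 \<or> T \<subseteq> D"
    using two_more_triangles by metis
  have "card (T1 - D) = 2"
    using T1 card_triangle finite_member by (simp add: card_Diff_subset_Int)
  then obtain a where a: "a \<in> T1" "a \<in> T2" "a \<notin> D"
    using at_most_one_private[OF T1(1), of "T1 - D"] family by blast
  obtain s where s: "T2 \<inter> (D \<union> T1) = {a, s}" "s \<noteq> a"
    using T2(2) a by (auto simp: card_2_iff)
  have "{a, s} \<in> G" using triangle_edge[OF subsetD[OF triangles T2(1)], of a s] s by blast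
  then have "s \<in> T1" using neighbour_of_pendant[OF T1 a(1,3)] s(1) by blast
  have "s \<in> {x, y}"
  proof (rule ccontr)
    assume "s \<notin> {x, y}"
    then have "{a, s} \<inter> {x, y} = {}" using a(3) by (auto simp: D_def)
    then obtain T where "T \<in> \<T>" "\<not> {x, y} \<subseteq> T" "\<not> {a, s} \<subseteq> T"
      using ex_off_spine_avoiding[of "{a, s}"] s(2) by (auto simp del: insert_subset)
    then show False using family spine_subset a s \<open>s \<in> T1\<close> by blast
  qed
  then show thesis using T1 T2(1) s(1) a \<open>s \<in> T1\<close> by (intro that[of T1 T2 a s]) auto
qed

lemma second_diamond:
  obtains s u a b c where "{s, u} = {x, y}" "{s, a, b} \<in> \<T>" "{s, a, c} \<in> \<T>"
    "distinct [s, u, z1, z2, a, b, c]"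
proof -
  obtain T1 T2 a s where T: "T1 \<in> \<T>" "T2 \<in> \<T>" and T1: "card (T1 \<inter> D) = 1" "a \<in> T1" "s \<in> T1"
    and T2: "T2 \<inter> (D \<union> T1) = {a, s}" and a: "a \<notin> D" and "s \<in> {x, y}"
    by (rule attachments_share_edge) blast
  then obtain u where u: "{s, u} = {x, y}" by blast
  then have centre: "distinct [s, u, z1, z2]" "D = {s, u, z1, z2}"
    using diamond_distinct by (auto simp: D_def doubleton_eq_iff)
  then have "s \<noteq> a" using a by auto
  have "a \<in> T2" "s \<in> T2" using T2 by blast+
  then have "card (T1 - {s, a}) = 1" "card (T2 - {s, a}) = 1"
    using \<open>s \<noteq> a\<close> T1(2,3) card_triangle T by (auto simp: card_Diff_subset)
  then obtain b c where b: "T1 - {s, a} = {b}" and c: "T2 - {s, a} = {c}"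
    by (auto simp: card_1_singleton_iff)
  obtain w where "T1 \<inter> D = {w}" using T1(1) by (rule card_1_singletonE)
  moreover have "s \<in> T1 \<inter> D" using T1(3) centre(2) by simp
  ultimately have "T1 \<inter> D = {s}" by simp
  then have "b \<notin> D" using b by blast
  moreover have "c \<notin> D \<union> T1" using c T2 by blast
  ultimately have "distinct [s, u, z1, z2, a, b, c]"
    using centre \<open>s \<noteq> a\<close> a T1(2) b by auto
  moreover have "T1 = {s, a, b}" "T2 = {s, a, c}" using b c T1(2,3) \<open>a \<in> T2\<close> \<open>s \<in> T2\<close> by blast+
  ultimately show thesis using that u T by blast
qed

end

section \<open>Copies of balanced graphs\<close>

definition copies :: "'b set set \<Rightarrow> 'a set set \<Rightarrow> 'a set set set" where
  "copies H G = {(`) f ` H | f. inj_on f (\<Union>H) \<and> (`) f ` H \<subseteq> G}"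

definition balanced :: "'a set set \<Rightarrow> bool" where
  "balanced H \<longleftrightarrow> (\<forall>J\<subseteq>\<Union>H. card (\<Union>H) * card (induced_edges H J) \<le> card H * card J)"

definition strictly_balanced :: "'a set set \<Rightarrow> bool" where
  "strictly_balanced H \<longleftrightarrow>
     (\<forall>J. J \<subset> \<Union>H \<and> J \<noteq> {} \<longrightarrow> card (\<Union>H) * card (induced_edges H J) < card H * card J)"

lemma copiesE:
  assumes "C \<in> copies H G"
  obtains f where "inj_on f (\<Union>H)" "C = (`) f ` H" "\<Union>C = f ` \<Union>H" "C \<subseteq> G"
  using assms that unfolding copies_def by blast

lemma finite_copies: "finite G \<Longrightarrow> finite (copies H G)"
  by (rule finite_subset[of _ "Pow G"]) (auto simp: copies_def)

lemma copies_subset_iff: "G \<subseteq> E \<Longrightarrow> C \<in> copies H G \<longleftrightarrow> C \<in> copies H E \<and> C \<subseteq> G"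
  by (auto simp: copies_def)

lemma card_copy: "C \<in> copies H G \<Longrightarrow> card C = card H"
  by (elim copiesE) (simp add: card_image inj_on_image)

lemma card_Union_copy: "C \<in> copies H G \<Longrightarrow> card (\<Union>C) = card (\<Union>H)"
  by (elim copiesE) (simp add: card_image)

lemma copies_induced_edges:
  assumes "C \<in> copies H G"
  obtains J where "J \<subseteq> \<Union>H" "card (induced_edges C S) = card (induced_edges H J)"
    "card (\<Union>C \<inter> S) = card J"
proof -
  obtain f where f: "inj_on f (\<Union>H)" "C = (`) f ` H" "\<Union>C = f ` \<Union>H"
    using assms by (rule copiesE)
  let ?J = "{i \<in> \<Union>H. f i \<in> S}"
  have J_subset: "?J \<subseteq> \<Union>H" by blast
  have "\<Union>C \<inter> S = f ` ?J" using f(3) by auto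
  then have vertices: "card (\<Union>C \<inter> S) = card ?J"
    using card_image[OF inj_on_subset[OF f(1) J_subset]] by metis
  have "f ` e \<subseteq> S \<longleftrightarrow> e \<subseteq> ?J" if "e \<in> H" for e using that by blast
  then have "induced_edges C S = (`) f ` induced_edges H ?J"
    unfolding f(2) induced_edges_def by blast
  moreover have "inj_on ((`) f) (induced_edges H ?J)"
    using inj_on_image[OF f(1)] by (rule inj_on_subset) (simp add: induced_edges_def)
  ultimately have "card (induced_edges C S) = card (induced_edges H ?J)"
    by (simp only: card_image)
  then show thesis using J_subset vertices by (intro that)
qed

lemma card_Int_le_induced_edges:
  "finite C \<Longrightarrow> card (C \<inter> D) \<le> card (induced_edges C (\<Union>D))"
  by (intro card_mono finite_induced_edges) (auto simp: induced_edges_def)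

lemma balanced_copy_Int:
  assumes balanced: "balanced H" "finite H" and copy: "C \<in> copies H G"
  shows "card (\<Union>H) * card (C \<inter> D) \<le> card H * card (\<Union>C \<inter> \<Union>D)"
proof -
  obtain J where J: "J \<subseteq> \<Union>H" "card (induced_edges C (\<Union>D)) = card (induced_edges H J)"
    "card (\<Union>C \<inter> \<Union>D) = card J"
    using copy by (rule copies_induced_edges)
  have "finite C" using copy balanced(2) by (elim copiesE) simp
  then have "card (\<Union>H) * card (C \<inter> D) \<le> card (\<Union>H) * card (induced_edges H J)"
    using card_Int_le_induced_edges[of C D] J(2) by simp
  also have "\<dots> \<le> card H * card J" using balanced(1) J(1) by (simp add: balanced_def)
  finally show ?thesis using J(3) by simp
qed

lemma strictly_balanced_copy_Int:
  assumes balanced: "strictly_balanced H" "finite H" "finite (\<Union>H)"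
    and copy: "C \<in> copies H G" "\<Union>C \<inter> \<Union>D \<noteq> {}" "\<not> \<Union>C \<subseteq> \<Union>D"
  shows "card (\<Union>H) * card (C \<inter> D) < card H * card (\<Union>C \<inter> \<Union>D)"
proof -
  obtain J where J: "J \<subseteq> \<Union>H" "card (induced_edges C (\<Union>D)) = card (induced_edges H J)"
    "card (\<Union>C \<inter> \<Union>D) = card J"
    using copy(1) by (rule copies_induced_edges)
  have fin: "finite C" "finite (\<Union>C)" using copy(1) balanced(2,3) by (elim copiesE; simp)+
  have "0 < card (\<Union>C \<inter> \<Union>D)" "card (\<Union>C \<inter> \<Union>D) < card (\<Union>C)"
    using copy(2,3) fin(2) by (auto simp: card_gt_0_iff intro: psubset_card_mono)
  then have "J \<noteq> {}" "J \<noteq> \<Union>H" using J(3) card_Union_copy[OF copy(1)] by auto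
  have "card (\<Union>H) * card (C \<inter> D) \<le> card (\<Union>H) * card (induced_edges H J)"
    using card_Int_le_induced_edges[OF fin(1), of D] J(2) by simp
  also have "\<dots> < card H * card J"
    using balanced(1) J(1) \<open>J \<noteq> {}\<close> \<open>J \<noteq> \<Union>H\<close> by (simp add: strictly_balanced_def psubset_eq)
  finally show ?thesis using J(3) by simp
qed

lemma strictly_balanced_imp_balanced:
  assumes "strictly_balanced H" "{} \<notin> H"
  shows "balanced H"
  unfolding balanced_def
proof (intro allI impI)
  fix J assume "J \<subseteq> \<Union>H"
  then consider "J = {}" | "J = \<Union>H" | "J \<subset> \<Union>H" "J \<noteq> {}" by blast
  then show "card (\<Union>H) * card (induced_edges H J) \<le> card H * card J"
  proof cases
    case 1
    then have "induced_edges H J = {}" using assms(2) by (auto simp: induced_edges_def)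
    then show ?thesis by simp
  next
    case 2
    then have "induced_edges H J = H" by (auto simp: induced_edges_def)
    then show ?thesis using 2 by simp
  next
    case 3
    then show ?thesis using assms(1) by (auto simp: strictly_balanced_def intro: less_imp_le)
  qed
qed

lemma overlapping_copies_dense:
  assumes balanced: "strictly_balanced H" "finite H" "finite (\<Union>H)"
    and copies: "C \<in> copies H G" "D \<in> copies H G" "C \<noteq> D" "\<Union>C \<inter> \<Union>D \<noteq> {}"
  shows "card H * card (\<Union>C \<union> \<Union>D) < card (\<Union>H) * card (C \<union> D)"
proof -
  let ?v = "card (\<Union>H)" and ?e = "card H"
  have fin: "finite C" "finite D" "finite (\<Union>C)" "finite (\<Union>D)"
    using copies(1,2) balanced(2,3) by (auto elim!: copiesE)
  note card = card_copy[OF copies(1)] card_copy[OF copies(2)]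
    card_Union_copy[OF copies(1)] card_Union_copy[OF copies(2)]
  have edges: "card (C \<union> D) + card (C \<inter> D) = 2 * ?e"
    and vertices: "card (\<Union>C \<union> \<Union>D) + card (\<Union>C \<inter> \<Union>D) = 2 * ?v"
    using card_Un_Int[OF fin(1,2)] card_Un_Int[OF fin(3,4)] card by simp_all
  show ?thesis
  proof (cases "\<Union>C \<subseteq> \<Union>D")
    case True
    then have "\<Union>C = \<Union>D" using fin card by (intro card_subset_eq) auto
    moreover have "0 < card (\<Union>C)" using copies(4) fin by (auto simp: card_gt_0_iff)
    moreover have "?e < card (C \<union> D)"
    proof -
      have "\<not> D \<subseteq> C" using copies(3) fin card card_subset_eq[of C D] by auto
      then show ?thesis using fin card psubset_card_mono[of "C \<union> D" C] by auto
    qed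
    ultimately show ?thesis using card by simp
  next
    case False
    then have "?v * card (C \<inter> D) < ?e * card (\<Union>C \<inter> \<Union>D)"
      using balanced copies(1,4) by (intro strictly_balanced_copy_Int)
    moreover have "?v * card (C \<union> D) + ?v * card (C \<inter> D) =
        ?e * card (\<Union>C \<union> \<Union>D) + ?e * card (\<Union>C \<inter> \<Union>D)"
      unfolding add_mult_distrib2[symmetric] edges vertices by simp
    ultimately show ?thesis by linarith
  qed
qed

section \<open>Double diamonds\<close>

lemma Union_DD_edges: "\<Union>DD_edges = {0..<7}"
  by (auto simp: DD_edges_def)

lemma DD_copies_eq: "DD_copies E = copies DD_edges E"
  by (simp add: DD_copies_def copies_def Union_DD_edges)

lemma card_DD_edges: "card DD_edges = 10"
  by (simp add: DD_edges_def doubleton_eq_iff)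

lemma DD_strictly_balanced: "strictly_balanced DD_edges"
  unfolding strictly_balanced_def induced_edges_def Union_DD_edges card_DD_edges
proof (intro allI impI)
  fix J :: "nat set" assume proper: "J \<subset> {0..<7} \<and> J \<noteq> {}"
  have vertices: "{0..<7::nat} = {0, 1, 2, 3, 4, 5, 6}" by auto
  have "\<forall>J\<in>Pow {0, 1, 2, 3, 4, 5, 6::nat} - {{}, {0, 1, 2, 3, 4, 5, 6}}.
      7 * card {e \<in> DD_edges. e \<subseteq> J} < 10 * card J"
    unfolding DD_edges_def by code_simp
  moreover have "J \<in> Pow {0, 1, 2, 3, 4, 5, 6} - {{}, {0, 1, 2, 3, 4, 5, 6}}"
    using proper unfolding vertices by blast
  ultimately show "card {0..<7::nat} * card {e \<in> DD_edges. e \<subseteq> J} < 10 * card J"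
    by simp
qed

lemma finite_DD_copy: "C \<in> DD_copies E \<Longrightarrow> finite C \<and> finite (\<Union>C)"
  unfolding DD_copies_eq using Union_DD_edges by (elim copiesE) (simp add: DD_edges_def)

lemma card_DD_copy: "C \<in> DD_copies E \<Longrightarrow> card C = 10 \<and> card (\<Union>C) = 7"
  unfolding DD_copies_eq by (simp add: card_copy card_Union_copy card_DD_edges Union_DD_edges)

lemma DD_copy_disjoint:
  assumes graph: "finite E" "locally_sparse E"
    and copies: "C \<in> DD_copies E" "D \<in> DD_copies E" "C \<noteq> D"
  shows "\<Union>C \<inter> \<Union>D = {}"
proof (rule ccontr)
  assume "\<Union>C \<inter> \<Union>D \<noteq> {}"
  then have "10 * card (\<Union>C \<union> \<Union>D) < 7 * card (C \<union> D)"
    using overlapping_copies_dense[OF DD_strictly_balanced, of C E D] copies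
    by (simp add: DD_copies_eq Union_DD_edges card_DD_edges) (simp add: DD_edges_def)
  moreover have "card (C \<union> D) \<le> card (induced_edges E (\<Union>C \<union> \<Union>D))"
    using copies graph(1) unfolding DD_copies_def
    by (intro card_mono finite_induced_edges) (auto simp: induced_edges_def)
  moreover have "0 \<le> weight E (\<Union>C \<union> \<Union>D)"
    using copies(1,2) finite_DD_copy card_DD_copy card_Un_le[of "\<Union>C" "\<Union>D"]
    by (intro locally_sparseD[OF graph(2)]) auto
  ultimately show False by (simp add: weight_def)
qed

lemma DD_copies_nonemptyI:
  assumes "{x, y, z1} \<in> triangles G" "{x, y, z2} \<in> triangles G"
    "{x, u, v} \<in> triangles G" "{x, u, w} \<in> triangles G"
    and distinct: "distinct [x, y, z1, z2, u, v, w]"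
  shows "DD_copies G \<noteq> {}"
proof -
  define f where "f i = [x, y, z1, z2, u, v, w] ! i" for i
  have "inj_on ((!) [x, y, z1, z2, u, v, w]) {0..<7}" using distinct by (intro inj_on_nth) auto
  then have "inj_on f {0..<7}" by (simp add: f_def[abs_def])
  moreover have "(`) f ` DD_edges \<subseteq> G"
    using assms by (simp add: DD_edges_def f_def insert3_in_triangles_iff)
  ultimately show ?thesis unfolding DD_copies_def by blast
qed

lemma ex_minimal_unpairable:
  assumes "finite \<S>" "\<not> pairable \<S>"
  shows "\<exists>\<T>\<subseteq>\<S>. \<not> pairable \<T> \<and> (\<forall>\<R>. \<R> \<subset> \<T> \<longrightarrow> pairable \<R>)"
proof -
  let ?\<Q> = "{\<T>. \<T> \<subseteq> \<S> \<and> \<not> pairable \<T>}"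
  have "finite ?\<Q>" "\<S> \<in> ?\<Q>" using assms by auto
  then obtain \<T> where \<T>: "\<T> \<in> ?\<Q>" "\<forall>\<R>\<in>?\<Q>. \<R> \<subseteq> \<T> \<longrightarrow> \<T> = \<R>"
    using finite_has_minimal2 by meson
  have "pairable \<R>" if "\<R> \<subset> \<T>" for \<R>
  proof (rule ccontr)
    assume "\<not> pairable \<R>"
    then have "\<R> \<in> ?\<Q>" using that \<T>(1) by auto
    then show False using that \<T>(2) by auto
  qed
  then show ?thesis using \<T>(1) by auto
qed

lemma locally_sparse_pairable:
  assumes graph: "finite G" "finite (\<Union>G)" "locally_sparse G" and no_DD: "DD_copies G = {}"
  shows "pairable (triangles G)"
proof (rule ccontr)
  assume unpairable: "\<not> pairable (triangles G)"
  have "triangles G \<subseteq> Pow (\<Union>G)" using triangle_subset_Union by blast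
  then have "finite (triangles G)" by (rule finite_subset) (simp add: graph(2))
  from ex_minimal_unpairable[OF this unpairable]
  obtain \<T> where \<T>: "\<T> \<subseteq> triangles G" "\<not> pairable \<T>" "\<forall>\<R>. \<R> \<subset> \<T> \<longrightarrow> pairable \<R>"
    by (elim exE conjE)
  interpret minimal_unpairable G \<T>
    using graph(1,3) \<T>(1,2) \<T>(3)[rule_format] by (rule minimal_unpairable.intro)
  obtain x y z1 z2 where "{x, y, z1} \<in> \<T>" "{x, y, z2} \<in> \<T>" "distinct [x, y, z1, z2]"
    by (rule ex_diamond)
  then interpret minimal_unpairable_diamond G \<T> x y z1 z2 by unfold_locales
  obtain s u a b c where centre: "{s, u} = {x, y}" and second: "{s, a, b} \<in> \<T>" "{s, a, c} \<in> \<T>"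
    and distinct: "distinct [s, u, z1, z2, a, b, c]"
    by (rule second_diamond)
  have "{s, u, z} = {x, y, z}" for z using centre by (auto simp: doubleton_eq_iff)
  then have "{s, u, z1} \<in> triangles G" "{s, u, z2} \<in> triangles G"
    using diamond_triangles triangles by auto
  moreover have "{s, a, b} \<in> triangles G" "{s, a, c} \<in> triangles G"
    using second triangles by auto
  ultimately have "DD_copies G \<noteq> {}" using distinct by (rule DD_copies_nonemptyI)
  with no_DD show False by simp
qed

lemma mwin_M_DD_copy:
  assumes copy: "C \<in> DD_copies E" "\<Union>C \<subseteq> V - B"
  shows "mwin_M V E {} B"
proof -
  obtain f where inj: "inj_on f {0..<7}" and embedded: "(`) f ` DD_edges \<subseteq> E"
    and C_eq: "C = (`) f ` DD_edges"
    using copy(1) unfolding DD_copies_def by auto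
  have "\<Union>C = f ` {0..<7}" unfolding C_eq Union_DD_edges[symmetric] by blast
  then have "f ` {0..<7} \<subseteq> V - B" using copy(2) by simp
  then have free: "f i \<in> V - B" if "i < 7" for i using that by (simp add: image_subset_iff)
  have neq: "f i = f j \<longleftrightarrow> i = j" if "i < 7" "j < 7" for i j
    using inj that by (auto simp: inj_on_def)
  have edges: "{{f 0, f 1}, {f 0, f 2}, {f 0, f 3}, {f 1, f 2}, {f 1, f 3}} \<subseteq> E"
    "{{f 0, f 4}, {f 0, f 5}, {f 0, f 6}, {f 4, f 5}, {f 4, f 6}} \<subseteq> E"
    using embedded by (auto simp: DD_edges_def)
  have "mwin_B V E {f 0} B"
  proof (rule mwin_B_two_diamonds)
    show "{f 1, f 2, f 3} \<subseteq> V - {f 0} - B" "{f 4, f 5, f 6} \<subseteq> V - {f 0} - B"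
      "{f 1, f 2, f 3} \<inter> {f 4, f 5, f 6} = {}"
      "distinct [f 1, f 2, f 3]" "distinct [f 4, f 5, f 6]"
      using free neq by auto
  qed (use edges in auto)
  then show ?thesis using free[of 0] by (intro moveM[of "f 0"]) auto
qed

lemma mwin_M_iff_DD_copy:
  assumes graph: "finite E" "locally_sparse E" "\<Union>E \<subseteq> V" "finite V"
  shows "mwin_M V E {} B \<longleftrightarrow> (\<exists>C\<in>DD_copies E. \<Union>C \<inter> B = {})"
proof
  let ?G = "{e \<in> E. e \<inter> B = {}}"
  assume "mwin_M V E {} B"
  then have "\<not> pairable (triangles ?G)" using pairable_not_mwin_M graph(3) by blast
  moreover have "finite ?G" "finite (\<Union>?G)"
    using graph by (auto intro: finite_subset[of _ V])
  moreover have "locally_sparse ?G" using graph(2) _ graph(1) by (rule locally_sparse_subset) blast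
  ultimately obtain C where "C \<in> DD_copies ?G" using locally_sparse_pairable by blast
  then have "C \<in> DD_copies E" "C \<subseteq> ?G" by (simp_all add: DD_copies_eq copies_subset_iff[of ?G E])
  then show "\<exists>C\<in>DD_copies E. \<Union>C \<inter> B = {}" by (intro bexI[of _ C]) auto
next
  assume "\<exists>C\<in>DD_copies E. \<Union>C \<inter> B = {}"
  then obtain C where C: "C \<in> DD_copies E" "\<Union>C \<inter> B = {}" ..
  moreover from C(1) have "\<Union>C \<subseteq> V" using graph(3) unfolding DD_copies_def by blast
  ultimately show "mwin_M V E {} B" by (intro mwin_M_DD_copy) auto
qed

lemma Kn_edges_eq: "Kn_edges n = [{0..<n}]\<^bsup>2\<^esup>"
  by (fastforce simp: Kn_edges_def nsets_2_eq)

lemma finite_Kn_edges: "finite (Kn_edges n)"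
  by (simp add: Kn_edges_eq finite_imp_finite_nsets)

context
  fixes n :: nat and E :: "nat set set"
  assumes E_subset: "E \<subseteq> Kn_edges n" and sparse: "locally_sparse E"
begin

lemma finite_E: "finite E" and Union_E: "\<Union>E \<subseteq> {0..<n}"
  using E_subset finite_subset[OF E_subset finite_Kn_edges] by (auto simp: Kn_edges_eq nsets_def)

lemma finite_DD_copies: "finite (DD_copies E)"
  unfolding DD_copies_eq using finite_E by (rule finite_copies)

lemma maker_first_win_iff: "maker_first_win n E \<longleftrightarrow> has_k_DD 1 E"
proof -
  have "maker_first_win n E \<longleftrightarrow> DD_copies E \<noteq> {}"
   
    unfolding maker_first_win_def
    using mwin_M_iff_DD_copy[OF finite_E sparse Union_E, of "{}"] by auto
  also have "\<dots> \<longleftrightarrow> has_k_DD 1 E"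
    using finite_DD_copies by (simp add: has_k_DD_def Suc_le_eq card_gt_0_iff)
  finally show ?thesis .
qed

lemma ex_vertex_in_all_DD_copies:
  assumes "0 < n" "card (DD_copies E) < 2"
  shows "\<exists>v\<in>{0..<n}. \<forall>C\<in>DD_copies E. v \<in> \<Union>C"
proof (cases "DD_copies E = {}")
  case False
  then obtain C where C: "C \<in> DD_copies E" by blast
  have unique: "D = C" if "D \<in> DD_copies E" for D
    using assms(2) that C finite_DD_copies by (auto simp: less_2_cases_iff card_1_singleton_iff)
  have "\<Union>C \<noteq> {}" using card_DD_copy[OF C] by (metis card.empty zero_neq_numeral)
  moreover have "\<Union>C \<subseteq> {0..<n}" using C Union_E unfolding DD_copies_def by blast
  ultimately show ?thesis using unique by blast
qed (use assms(1) in auto)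

lemma maker_second_win_iff:
  assumes "0 < n"
  shows "maker_second_win n E \<longleftrightarrow> has_k_DD 2 E"
proof -
  have "maker_second_win n E \<longleftrightarrow> (\<forall>v\<in>{0..<n}. mwin_M {0..<n} E {} {v})"
    unfolding maker_second_win_def
    using mwin_B_iff_all_moves[of "{0..<n}" "{}" "{}" E] assms by (simp add: has_triangle_def)
  also have "\<dots> \<longleftrightarrow> (\<forall>v\<in>{0..<n}. \<exists>C\<in>DD_copies E. v \<notin> \<Union>C)"
    using mwin_M_iff_DD_copy[OF finite_E sparse Union_E] by auto
  also have "\<dots> \<longleftrightarrow> 2 \<le> card (DD_copies E)"
  proof
    assume "\<forall>v\<in>{0..<n}. \<exists>C\<in>DD_copies E. v \<notin> \<Union>C"
    then show "2 \<le> card (DD_copies E)" using ex_vertex_in_all_DD_copies[OF assms] by (meson not_le)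
  next
    assume "2 \<le> card (DD_copies E)"
    then obtain C D where "C \<in> DD_copies E" "D \<in> DD_copies E" "C \<noteq> D"
      by (metis card_le_Suc0_iff_eq finite_DD_copies not_less_eq_eq numeral_2_eq_2)
    moreover from this have "\<Union>C \<inter> \<Union>D = {}" by (rule DD_copy_disjoint[OF finite_E sparse])
    ultimately have "\<exists>C\<in>DD_copies E. v \<notin> \<Union>C" for v
      by (cases "v \<in> \<Union>C") (auto intro: bexI[of _ C] bexI[of _ D])
    then show "\<forall>v\<in>{0..<n}. \<exists>C\<in>DD_copies E. v \<notin> \<Union>C" by blast
  qed
  finally show ?thesis by (simp add: has_k_DD_def)
qed

end

section \<open>Uniformly random subsets\<close>

abbreviation random_nset :: "'a set \<Rightarrow> nat \<Rightarrow> 'a set pmf" where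
  "random_nset A N \<equiv> pmf_of_set ([A]\<^bsup>N\<^esup>)"

lemma nsets_nonempty: "N \<le> card A \<Longrightarrow> [A]\<^bsup>N\<^esup> \<noteq> {}"
  by (simp add: nsets_eq_empty_iff)

lemma prob_random_nset_mono:
  assumes "finite A" "N \<le> card A" "\<And>U. U \<in> [A]\<^bsup>N\<^esup> \<Longrightarrow> P U \<Longrightarrow> Q U"
  shows "measure_pmf.prob (random_nset A N) {U. P U} \<le> measure_pmf.prob (random_nset A N) {U. Q U}"
  using assms nsets_nonempty[OF assms(2)]
  by (intro measure_pmf.finite_measure_mono_AE)
    (auto simp: AE_measure_pmf_iff finite_imp_finite_nsets)

definition containment_prob :: "nat \<Rightarrow> nat \<Rightarrow> nat \<Rightarrow> real" where
  "containment_prob N M s = real (N choose s) / real (M choose s)"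

lemma containment_prob_eq_prod:
  "containment_prob N M s = (\<Prod>i<s. (real N - real i) / (real M - real i))"
  by (simp add: containment_prob_def binomial_gbinomial gbinomial_prod_rev prod_dividef atLeast0LessThan)

lemma containment_prob_nonneg: "0 \<le> containment_prob N M s"
  by (simp add: containment_prob_def)

lemma card_nsets_superset:
  assumes "finite A" "F \<subseteq> A" "card F \<le> N"
  shows "card {U \<in> [A]\<^bsup>N\<^esup>. F \<subseteq> U} = (card A - card F) choose (N - card F)"
proof -
  have finite_F: "finite F" using assms(1,2) finite_subset by blast
  have "bij_betw (\<lambda>W. W \<union> F) ([A - F]\<^bsup>(N - card F)\<^esup>) {U \<in> [A]\<^bsup>N\<^esup>. F \<subseteq> U}"
  proof (rule bij_betw_byWitness[where f' = "\<lambda>U. U - F"])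
    show "(\<lambda>W. W \<union> F) ` [A - F]\<^bsup>(N - card F)\<^esup> \<subseteq> {U \<in> [A]\<^bsup>N\<^esup>. F \<subseteq> U}"
    proof clarify
      fix W assume W: "W \<in> [A - F]\<^bsup>(N - card F)\<^esup>"
      then have "card (W \<union> F) = N"
        using finite_F assms(3) by (subst card_Un_disjoint) (auto simp: nsets_def)
      then show "W \<union> F \<in> [A]\<^bsup>N\<^esup> \<and> F \<subseteq> W \<union> F" using W finite_F assms(2) by (auto simp: nsets_def)
    qed
    show "(\<lambda>U. U - F) ` {U \<in> [A]\<^bsup>N\<^esup>. F \<subseteq> U} \<subseteq> [A - F]\<^bsup>(N - card F)\<^esup>"
      using finite_F by (auto simp: nsets_def card_Diff_subset)
  qed (auto simp: nsets_def)
  then have "card {U \<in> [A]\<^bsup>N\<^esup>. F \<subseteq> U} = card ([A - F]\<^bsup>(N - card F)\<^esup>)"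
    by (rule bij_betw_same_card[symmetric])
  then show ?thesis using finite_F assms(2) by (simp add: card_Diff_subset)
qed

lemma prob_random_nset_superset:
  assumes carrier: "finite A" "N \<le> card A" and F_subset: "F \<subseteq> A"
  shows "measure_pmf.prob (random_nset A N) {U. F \<subseteq> U} = containment_prob N (card A) (card F)"
proof -
  let ?M = "card A" and ?s = "card F"
  have "measure_pmf.prob (random_nset A N) {U. F \<subseteq> U} =
      real (card {U \<in> [A]\<^bsup>N\<^esup>. F \<subseteq> U}) / real (?M choose N)"
    using measure_pmf_of_set[OF nsets_nonempty[OF carrier(2)]
        finite_imp_finite_nsets[OF carrier(1)], of "{U. F \<subseteq> U}"]
    by (simp add: Int_def)
  also have "\<dots> = containment_prob N ?M ?s"
  proof (cases "?s \<le> N")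
    case True
    then have "real (?M choose N) * real (N choose ?s) =
        real (?M choose ?s) * real ((?M - ?s) choose (N - ?s))"
      using choose_mult[OF True carrier(2)] by (metis of_nat_mult)
    moreover have "?M choose N > 0" "?M choose ?s > 0"
      using carrier card_mono[OF carrier(1) F_subset] by (simp_all add: zero_less_binomial)
    ultimately show ?thesis
      using card_nsets_superset[OF carrier(1) F_subset True]
      by (simp add: containment_prob_def field_simps)
  next
    case False
    have "{U \<in> [A]\<^bsup>N\<^esup>. F \<subseteq> U} = {}"
      using False card_mono[of _ F] by (auto simp: nsets_def)
    then have "card {U \<in> [A]\<^bsup>N\<^esup>. F \<subseteq> U} = 0" by (simp only: card.empty)
    then show ?thesis using False by (simp add: containment_prob_def)
  qed
  finally show ?thesis .
qed

context
  fixes N M :: nat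
  assumes N_le_M: "N \<le> M"
begin

lemma containment_prob_le: "containment_prob N M s \<le> (real N / real M) ^ s"
proof (cases "s \<le> N")
  case True
  have "containment_prob N M s \<le> (\<Prod>i<s. real N / real M)"
    unfolding containment_prob_eq_prod
  proof (rule prod_mono)
    fix i assume "i \<in> {..<s}"
    then have i_less: "i < N" using True by simp
    have "real i * real N \<le> real i * real M" using N_le_M by (intro mult_left_mono) auto
    then show "0 \<le> (real N - real i) / (real M - real i) \<and>
        (real N - real i) / (real M - real i) \<le> real N / real M"
      using i_less N_le_M by (simp add: divide_simps algebra_simps)
  qed
  then show ?thesis by simp
qed (simp add: containment_prob_def binomial_eq_0)

lemma containment_prob_ge:
  assumes "2 * s \<le> N"
  shows "(real N / real M / 2) ^ s \<le> containment_prob N M s"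
proof -
  have "(\<Prod>i<s. real N / real M / 2) \<le> containment_prob N M s"
    unfolding containment_prob_eq_prod
  proof (rule prod_mono)
    fix i assume "i \<in> {..<s}"
    then have i_less: "2 * i < N" using assms by simp
    have "real N / real M / 2 \<le> (real N - real i) / real M" using i_less N_le_M
      by (simp add: divide_simps)
    also have "\<dots> \<le> (real N - real i) / (real M - real i)"
      using i_less N_le_M by (intro divide_left_mono) auto
    finally show "0 \<le> real N / real M / 2 \<and>
        real N / real M / 2 \<le> (real N - real i) / (real M - real i)" by simp
  qed
  then show ?thesis by simp
qed

lemma containment_prob_add_le:
  "containment_prob N M (s + t) \<le> containment_prob N M s * containment_prob N M t"
proof (cases "s + t \<le> N")
  case True
  let ?r = "\<lambda>i. (real N - real i) / (real M - real i)"
  have "containment_prob N M (s + t) = containment_prob N M s * (\<Prod>i<t. ?r (s + i))"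
    unfolding containment_prob_eq_prod by (induction t) (simp_all add: algebra_simps)
  also have "\<dots> \<le> containment_prob N M s * containment_prob N M t"
    unfolding containment_prob_eq_prod[of N M t]
  proof (intro mult_left_mono prod_mono containment_prob_nonneg)
    fix i assume "i \<in> {..<t}"
    then have i_less: "s + i < N" using True by simp
    have "real s * real N \<le> real s * real M" using N_le_M by (intro mult_left_mono) auto
    then show "0 \<le> ?r (s + i) \<and> ?r (s + i) \<le> ?r i"
      using i_less N_le_M by (simp add: divide_simps algebra_simps)
  qed
  finally show ?thesis .
qed (simp add: containment_prob_def binomial_eq_0)

end

lemma prob_random_nset_superset_Union_le:
  assumes carrier: "finite A" "N \<le> card A" and family: "finite \<F>" "\<And>F. F \<in> \<F> \<Longrightarrow> F \<subseteq> A \<and> card F = t"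
  shows "measure_pmf.prob (random_nset A N) {U. \<exists>F\<in>\<F>. F \<subseteq> U} \<le>
    real (card \<F>) * (real N / real (card A)) ^ t"
proof -
  let ?\<Omega> = "random_nset A N"
  have "{U. \<exists>F\<in>\<F>. F \<subseteq> U} = (\<Union>F\<in>\<F>. {U. F \<subseteq> U})" by blast
  then have "measure_pmf.prob ?\<Omega> {U. \<exists>F\<in>\<F>. F \<subseteq> U} \<le> (\<Sum>F\<in>\<F>. measure_pmf.prob ?\<Omega> {U. F \<subseteq> U})"
    using measure_UNION_le[OF family(1), of "\<lambda>F. {U. F \<subseteq> U}" "measure_pmf ?\<Omega>"] by simp
  also have "\<dots> \<le> (\<Sum>F\<in>\<F>. (real N / real (card A)) ^ t)"
  proof (rule sum_mono)
    fix F assume F: "F \<in> \<F>"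
    then show "measure_pmf.prob ?\<Omega> {U. F \<subseteq> U} \<le> (real N / real (card A)) ^ t"
      using prob_random_nset_superset[OF carrier, of F] containment_prob_le[OF carrier(2), of t]
        family(2)[OF F] by simp
  qed
  finally show ?thesis by simp
qed

section \<open>The second moment method\<close>

definition num_contained :: "'a set set \<Rightarrow> 'a set \<Rightarrow> nat" where
  "num_contained \<F> U = card {F \<in> \<F>. F \<subseteq> U}"

lemma num_contained_eq_sum:
  "finite \<F> \<Longrightarrow> real (num_contained \<F> U) = (\<Sum>F\<in>\<F>. indicator {U. F \<subseteq> U} U)"
  by (simp add: num_contained_def indicator_def sum.If_cases Int_def)

definition overlap_sum :: "real \<Rightarrow> 'a set set \<Rightarrow> real" where
  "overlap_sum p \<F> = (\<Sum>F\<in>\<F>. \<Sum>F'\<in>{F' \<in> \<F>. F \<inter> F' \<noteq> {}}. p ^ card (F \<union> F'))"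

context
  fixes A :: "'a set" and N t :: nat and \<F> :: "'a set set"
  assumes carrier: "finite A" "N \<le> card A"
    and family: "finite \<F>" "\<And>F. F \<in> \<F> \<Longrightarrow> F \<subseteq> A \<and> card F = t"
begin

abbreviation (input) \<Omega> :: "'a set pmf" where
  "\<Omega> \<equiv> random_nset A N"

abbreviation (input) X :: "'a set \<Rightarrow> real" where
  "X U \<equiv> real (num_contained \<F> U)"

abbreviation (input) \<mu> :: real where
  "\<mu> \<equiv> real (card \<F>) * containment_prob N (card A) t"

lemma integrable_random_nset: "integrable \<Omega> (f :: 'a set \<Rightarrow> real)"
  using carrier by (intro integrable_measure_pmf_finite)
    (simp add: nsets_nonempty finite_imp_finite_nsets)

lemma expectation_num_contained: "measure_pmf.expectation \<Omega> (\<lambda>U. X U) = \<mu>"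
proof -
  have "measure_pmf.expectation \<Omega> (\<lambda>U. X U) = (\<Sum>F\<in>\<F>. measure_pmf.prob \<Omega> {U. F \<subseteq> U})"
    unfolding num_contained_eq_sum[OF family(1)]
    using integrable_random_nset by (simp add: Bochner_Integration.integral_sum)
  also have "\<dots> = \<mu>" using prob_random_nset_superset[OF carrier] family(2) by simp
  finally show ?thesis .
qed

lemma expectation_num_contained_squared:
  "measure_pmf.expectation \<Omega> (\<lambda>U. (X U)\<^sup>2) =
    (\<Sum>F\<in>\<F>. \<Sum>F'\<in>\<F>. containment_prob N (card A) (card (F \<union> F')))"
proof -
  have "(X U)\<^sup>2 = (\<Sum>F\<in>\<F>. \<Sum>F'\<in>\<F>. indicator {U. F \<union> F' \<subseteq> U} U)" for U
    unfolding power2_eq_square num_contained_eq_sum[OF family(1)] sum_product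
    by (intro sum.cong refl) (simp add: indicator_def)
  then have "measure_pmf.expectation \<Omega> (\<lambda>U. (X U)\<^sup>2) =
      (\<Sum>F\<in>\<F>. \<Sum>F'\<in>\<F>. measure_pmf.prob \<Omega> {U. F \<union> F' \<subseteq> U})"
    using integrable_random_nset by (simp add: Bochner_Integration.integral_sum)
  also have "\<dots> = (\<Sum>F\<in>\<F>. \<Sum>F'\<in>\<F>. containment_prob N (card A) (card (F \<union> F')))"
    using family(2) by (intro sum.cong refl prob_random_nset_superset[OF carrier]) auto
  finally show ?thesis .
qed

lemma variance_num_contained_le:
  "measure_pmf.variance \<Omega> (\<lambda>U. X U) \<le> overlap_sum (real N / real (card A)) \<F>"
proof -
  let ?q = "containment_prob N (card A)" and ?p = "real N / real (card A)"
  have pair: "?q (card (F \<union> F')) \<le> (?q t)\<^sup>2 + (if F \<inter> F' \<noteq> {} then ?p ^ card (F \<union> F') else 0)"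
    if "F \<in> \<F>" "F' \<in> \<F>" for F F'
  proof (cases "F \<inter> F' = {}")
    case True
    then have "card (F \<union> F') = t + t"
      using family(2)[OF that(1)] family(2)[OF that(2)] finite_subset[OF _ carrier(1)]
      by (simp add: card_Un_disjoint)
    then show ?thesis
      using containment_prob_add_le[OF carrier(2), of t t] True by (simp add: power2_eq_square)
  next
    case False
    then show ?thesis
      using containment_prob_le[OF carrier(2), of "card (F \<union> F')"] by (auto intro: add_increasing)
  qed
  have "measure_pmf.expectation \<Omega> (\<lambda>U. (X U)\<^sup>2) \<le>
      (\<Sum>F\<in>\<F>. \<Sum>F'\<in>\<F>. (?q t)\<^sup>2 + (if F \<inter> F' \<noteq> {} then ?p ^ card (F \<union> F') else 0))"
    unfolding expectation_num_contained_squared using pair by (intro sum_mono)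
  also have "\<dots> = \<mu>\<^sup>2 + overlap_sum ?p \<F>"
    using family(1)
    by (simp add: overlap_sum_def sum.distrib sum.inter_filter power2_eq_square algebra_simps)
  finally have second_moment:
    "measure_pmf.expectation \<Omega> (\<lambda>U. (X U)\<^sup>2) \<le> \<mu>\<^sup>2 + overlap_sum ?p \<F>" .
  have "measure_pmf.variance \<Omega> (\<lambda>U. X U) = measure_pmf.expectation \<Omega> (\<lambda>U. (X U)\<^sup>2) - \<mu>\<^sup>2"
    using measure_pmf.variance_eq[of \<Omega> "\<lambda>U. X U"] integrable_random_nset
    by (simp add: expectation_num_contained)
  with second_moment show ?thesis by linarith
qed

lemma prob_num_contained_less_le:
  assumes "0 < \<mu>" "2 * real k \<le> \<mu>"
  shows "measure_pmf.prob \<Omega> {U. num_contained \<F> U < k} \<le>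
    4 * overlap_sum (real N / real (card A)) \<F> / \<mu>\<^sup>2"
proof -
  have "measure_pmf.prob \<Omega> {U. num_contained \<F> U < k} \<le>
      measure_pmf.prob \<Omega> {U \<in> space \<Omega>. \<mu> / 2 \<le> \<bar>X U - measure_pmf.expectation \<Omega> (\<lambda>U. X U)\<bar>}"
    unfolding expectation_num_contained using assms(2)
    by (intro measure_pmf.finite_measure_mono) auto
  also have "\<dots> \<le> measure_pmf.variance \<Omega> (\<lambda>U. X U) / (\<mu> / 2)\<^sup>2"
    using assms(1) integrable_random_nset by (intro measure_pmf.Chebyshev_inequality) simp_all
  also have "\<dots> \<le> overlap_sum (real N / real (card A)) \<F> / (\<mu> / 2)\<^sup>2"
    using variance_num_contained_le by (intro divide_right_mono) simp_all
  finally show ?thesis by (simp add: power_divide mult.commute)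
qed

end

section \<open>Copies of a balanced graph in a random graph\<close>

abbreviation random_graph :: "nat \<Rightarrow> nat \<Rightarrow> nat set set pmf" where
  "random_graph n N \<equiv> random_nset (Kn_edges n) N"

definition edge_density :: "nat \<Rightarrow> nat \<Rightarrow> real" where
  "edge_density n N = real N / real (n choose 2)"

lemma card_Kn_edges: "card (Kn_edges n) = n choose 2"
  by (simp add: Kn_edges_eq)

lemma real_choose_two: "real (n choose 2) = real n * (real n - 1) / 2"
  by (cases n) (simp_all add: choose_two real_of_nat_div algebra_simps)

lemma edge_density_nonneg: "0 \<le> edge_density n N"
  by (simp add: edge_density_def)

lemma edge_density_le_1:
  assumes "N \<le> n choose 2"
  shows "edge_density n N \<le> 1"
proof -
  have "real a / real b \<le> 1" if "a \<le> b" for a b :: nat using that by (cases "b = 0") auto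
  then show ?thesis unfolding edge_density_def using assms .
qed

lemma edge_density_le:
  assumes "2 \<le> n"
  shows "edge_density n N \<le> 4 * real N / real n ^ 2"
proof -
  have "real n ^ 2 / 4 \<le> real (n choose 2)"
    using assms by (simp add: real_choose_two power2_eq_square field_simps)
  then have "real N / real (n choose 2) \<le> real N / (real n ^ 2 / 4)"
    using assms by (intro divide_left_mono) (auto intro: divide_pos_pos)
  then show ?thesis by (simp add: edge_density_def field_simps)
qed

lemma of_nat_div_ge_half:
  assumes "0 < v" "v \<le> n"
  shows "1 / (2 * real v) * real n \<le> real (n div v)"
proof -
  have "0 < n div v" using assms by (simp add: div_greater_zero_iff)
  then have "v * 1 \<le> v * (n div v)" by (intro mult_le_mono2) simp
  moreover have "n < v * (n div v) + v" using dividend_less_times_div[OF assms(1), of n] by simp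
  ultimately have "n \<le> 2 * v * (n div v)" by linarith
  then have "real n \<le> real (2 * v * (n div v))" by (rule of_nat_mono)
  then show ?thesis using assms(1) by (simp add: field_simps)
qed

lemma filterlim_power_div_mult_at_top:
  fixes q :: "nat \<Rightarrow> real"
  assumes v: "0 < v" and q: "\<And>n. 0 \<le> q n"
    and top: "filterlim (\<lambda>n. real n ^ v * q n) at_top sequentially"
  shows "filterlim (\<lambda>n. real (n div v) ^ v * q n) at_top sequentially"
proof (rule filterlim_at_top_mono)
  show "filterlim (\<lambda>n. (1 / (2 * real v)) ^ v * (real n ^ v * q n)) at_top sequentially"
    using v by (intro filterlim_tendsto_pos_mult_at_top[OF tendsto_const _ top]) auto
  show "\<forall>\<^sub>F n in sequentially. (1 / (2 * real v)) ^ v * (real n ^ v * q n) \<le> real (n div v) ^ v * q n"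
    using eventually_ge_at_top[of v]
  proof eventually_elim
    case (elim n)
    have "1 / (2 * real v) * real n \<le> real (n div v)" using v elim by (rule of_nat_div_ge_half)
    then have "(1 / (2 * real v) * real n) ^ v \<le> real (n div v) ^ v" by (intro power_mono) auto
    then show ?case
      unfolding power_mult_distrib mult.assoc[symmetric] by (intro mult_right_mono q)
  qed
qed

text \<open>Vertex \<open>i\<close> is put into the \<open>i\<close>-th block of \<open>m\<close> vertices, so two placements share a vertex only
  by agreeing on it.\<close>
definition placements :: "nat \<Rightarrow> nat \<Rightarrow> (nat \<Rightarrow> nat) set" where
  "placements v m = (\<Pi>\<^sub>E i\<in>{0..<v}. {i * m..<Suc i * m})"

definition agreement :: "nat \<Rightarrow> (nat \<Rightarrow> nat) \<Rightarrow> (nat \<Rightarrow> nat) \<Rightarrow> nat set" where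
  "agreement v f g = {i \<in> {0..<v}. f i = g i}"

lemma finite_placements: "finite (placements v m)"
  unfolding placements_def by (intro finite_PiE) auto

lemma card_placements: "card (placements v m) = m ^ v"
  unfolding placements_def by (subst card_PiE) auto

lemma placement_block:
  assumes "f \<in> placements v m" "i < v"
  shows "f i div m = i" "f i < v * m"
proof -
  have bounds: "i * m \<le> f i" "f i < Suc i * m"
    using PiE_mem[of f _ _ i] assms by (auto simp: placements_def)
  then show "f i div m = i" by (intro div_nat_eqI) (auto simp: mult.commute)
  have "Suc i * m \<le> v * m" using assms by (intro mult_right_mono) auto
  then show "f i < v * m" using bounds by linarith
qed

lemma placements_eqD:
  assumes "f \<in> placements v m" "g \<in> placements v m" "i < v" "j < v" "f i = g j"
  shows "i = j"
  using placement_block[OF assms(1,3)] placement_block[OF assms(2,4)] assms(5) by simp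

lemma placement_inj_on: "f \<in> placements v m \<Longrightarrow> inj_on f {0..<v}"
  using placements_eqD by (intro inj_onI) (metis atLeastLessThan_iff)

lemma placements_image_Int:
  assumes "f \<in> placements v m" "g \<in> placements v m"
  shows "f ` {0..<v} \<inter> g ` {0..<v} = f ` agreement v f g"
proof (intro equalityI subsetI)
  fix w assume "w \<in> f ` {0..<v} \<inter> g ` {0..<v}"
  then obtain i j where ij: "i < v" "j < v" "w = f i" "f i = g j" by auto
  then have "i = j" using placements_eqD[OF assms] by blast
  then show "w \<in> f ` agreement v f g" using ij by (auto simp: agreement_def)
next
  fix w assume "w \<in> f ` agreement v f g"
  then obtain i where "i \<in> {0..<v}" "w = f i" "f i = g i" by (auto simp: agreement_def)
  then show "w \<in> f ` {0..<v} \<inter> g ` {0..<v}" by (metis IntI imageI)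
qed

lemma card_placements_agreement_le:
  assumes "f \<in> placements v m" "Q \<subseteq> {0..<v}"
  shows "card {g \<in> placements v m. agreement v f g = Q} \<le> m ^ (v - card Q)"
proof -
  let ?P = "\<Pi>\<^sub>E i\<in>{0..<v}. if i \<in> Q then {f i} else {i * m..<Suc i * m}"
  have "g \<in> ?P" if "g \<in> placements v m" "agreement v f g = Q" for g
  proof -
    have "g i = f i" if "i \<in> Q" for i
      using that \<open>agreement v f g = Q\<close> by (auto simp: agreement_def)
    then show ?thesis using that(1) unfolding placements_def PiE_iff by simp
  qed
  then have "{g \<in> placements v m. agreement v f g = Q} \<subseteq> ?P" by blast
  then have "card {g \<in> placements v m. agreement v f g = Q} \<le> card ?P"
    by (intro card_mono finite_PiE) auto
  also have "\<dots> = (\<Prod>i\<in>{0..<v}. if i \<in> Q then 1 else m)"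
    by (subst card_PiE) (auto intro!: prod.cong)
  also have "\<dots> = m ^ card ({0..<v} - Q)"
    by (simp add: prod.If_cases Diff_eq)
  also have "card ({0..<v} - Q) = v - card Q"
    using assms(2) finite_subset[OF assms(2)] by (simp add: card_Diff_subset)
  finally show ?thesis .
qed

lemma sum_power_card_agreement_le:
  assumes f: "f \<in> placements v m"
  shows "(\<Sum>g\<in>placements v m. m ^ card (agreement v f g)) \<le> 2 ^ v * m ^ v"
proof -
  have "(\<Sum>g\<in>placements v m. m ^ card (agreement v f g)) =
      (\<Sum>Q\<in>Pow {0..<v}. \<Sum>g\<in>{g \<in> placements v m. agreement v f g = Q}. m ^ card (agreement v f g))"
    by (rule sum.group[symmetric]) (auto simp: finite_placements agreement_def)
  also have "\<dots> \<le> (\<Sum>Q\<in>Pow {0..<v}. m ^ v)"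
  proof (rule sum_mono)
    fix Q assume Q: "Q \<in> Pow {0..<v}"
    have "(\<Sum>g\<in>{g \<in> placements v m. agreement v f g = Q}. m ^ card (agreement v f g)) =
        card {g \<in> placements v m. agreement v f g = Q} * m ^ card Q" by simp
    also have "\<dots> \<le> m ^ (v - card Q) * m ^ card Q"
      using card_placements_agreement_le[OF f, of Q] Q by simp
    also have "\<dots> = m ^ v"
      using card_mono[of "{0..<v}" Q] Q by (simp flip: power_add)
    finally show "(\<Sum>g\<in>{g \<in> placements v m. agreement v f g = Q}. m ^ card (agreement v f g)) \<le> m ^ v" .
  qed
  also have "\<dots> = 2 ^ v * m ^ v" by (simp add: card_Pow)
  finally show ?thesis .
qed

lemma one_le_powr_mult_power:
  fixes m p :: real
  assumes p_bounds: "0 < p" "p \<le> 1" and m_pos: "0 < m" and one_le: "1 \<le> m ^ v * p ^ e"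
    and exponents: "0 < v" "0 < a" "v * j \<le> e * a"
  shows "1 \<le> (m ^ v * p ^ e) powr (- 1 / v) * (m ^ a * p ^ j)"
proof -
  let ?\<psi> = "m ^ v * p ^ e" and ?x = "m ^ a * p ^ j"
  have x_pos: "0 < ?x" using p_bounds m_pos by simp
  have "?\<psi> \<le> ?\<psi> ^ a" using one_le exponents(2) by (intro self_le_power)
  also have "\<dots> = m ^ (a * v) * p ^ (e * a)"
    by (simp add: power_mult_distrib power_mult mult.commute flip: power_mult)
  also have "\<dots> \<le> m ^ (a * v) * p ^ (v * j)"
    using p_bounds m_pos exponents(3) by (intro mult_left_mono power_decreasing) auto
  also have "\<dots> = ?x ^ v" by (simp add: power_mult_distrib mult.commute flip: power_mult)
  finally have "?\<psi> \<le> ?x powr v" using x_pos by (simp add: powr_realpow)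
  then have "?\<psi> powr (1 / v) \<le> (?x powr v) powr (1 / v)"
    using one_le by (intro powr_mono2) auto
  also have "\<dots> = ?x" using x_pos exponents(1) by (simp add: powr_powr)
  finally have "?\<psi> powr (- 1 / v) * ?\<psi> powr (1 / v) \<le> ?\<psi> powr (- 1 / v) * ?x"
    by (intro mult_left_mono) auto
  moreover have "?\<psi> powr (- 1 / v) * ?\<psi> powr (1 / v) = 1"
    using m_pos p_bounds by (subst powr_add[symmetric]) simp
  ultimately show ?thesis by simp
qed

locale balanced_pattern =
  fixes H :: "nat set set" and v :: nat
  assumes edges: "H \<subseteq> [{0..<v}]\<^bsup>2\<^esup>" and vertices: "\<Union>H = {0..<v}" and v_pos: "0 < v"
    and balanced: "balanced H"
begin

abbreviation e :: nat where
  "e \<equiv> card H"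

abbreviation placed :: "(nat \<Rightarrow> nat) \<Rightarrow> nat set set" where
  "placed f \<equiv> (`) f ` H"

lemma finite_H: "finite H"
  using edges by (rule finite_subset) (simp add: finite_imp_finite_nsets)

lemma e_pos: "0 < e"
proof -
  have "H \<noteq> {}" using vertices v_pos by auto
  then show ?thesis using finite_H by (simp add: card_gt_0_iff)
qed

lemma v_le_two_e: "v \<le> 2 * e"
proof -
  have "card (\<Union>H) \<le> (\<Sum>h\<in>H. card h)"
    by (rule card_Union_le_sum_card)
  also have "\<dots> = (\<Sum>h\<in>H. 2)" using edges by (intro sum.cong) (auto simp: nsets_def)
  finally show ?thesis using vertices by simp
qed

lemma Union_placed: "\<Union>(placed f) = f ` {0..<v}"
  unfolding vertices[symmetric] by blast

lemma placed_in_copies: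
  assumes "f \<in> placements v m" "v * m \<le> n"
  shows "placed f \<in> copies H (Kn_edges n)"
proof -
  note inj = placement_inj_on[OF assms(1)]
  have "f ` h \<in> Kn_edges n" if "h \<in> H" for h
  proof -
    have h: "h \<subseteq> {0..<v}" "card h = 2" using that edges by (auto simp: nsets_def)
    then have "card (f ` h) = 2" using card_image[OF inj_on_subset[OF inj]] by metis
    moreover have "f ` {0..<v} \<subseteq> {0..<n}"
      using placement_block(2)[OF assms(1)] assms(2) by fastforce
    ultimately show ?thesis
      using h(1) by (auto simp: Kn_edges_eq nsets_def intro: card_ge_0_finite)
  qed
  then have "placed f \<subseteq> Kn_edges n" by blast
  then show ?thesis
    unfolding copies_def using inj vertices by auto
qed

lemma inj_on_placed: "inj_on placed (placements v m)"
proof (rule inj_onI)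
  fix f g assume fg: "f \<in> placements v m" "g \<in> placements v m" "placed f = placed g"
  then have "f ` {0..<v} = g ` {0..<v}" using Union_placed by metis
  then have "f ` {0..<v} = f ` agreement v f g" using placements_image_Int[OF fg(1,2)] by simp
  moreover have "agreement v f g \<subseteq> {0..<v}" by (auto simp: agreement_def)
  ultimately have "{0..<v} = agreement v f g"
    using inj_on_image_eq_iff[OF placement_inj_on[OF fg(1)] order_refl] by metis
  then have "f i = g i" if "i \<in> {0..<v}" for i
    using that unfolding agreement_def by blast
  then show "f = g"
    using fg(1,2) unfolding placements_def by (intro PiE_ext) auto
qed

lemma card_placed_Int_le:
  assumes "f \<in> placements v m" "g \<in> placements v m"
  shows "v * card (placed f \<inter> placed g) \<le> e * card (agreement v f g)"
proof -
  have "v * card (placed f \<inter> placed g) \<le> e * card (\<Union>(placed f) \<inter> \<Union>(placed g))"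
    using balanced_copy_Int[OF balanced finite_H placed_in_copies[OF assms(1) order_refl]] vertices
    by simp
  also have "\<Union>(placed f) \<inter> \<Union>(placed g) = f ` agreement v f g"
    using placements_image_Int[OF assms] by (simp only: Union_placed)
  also have "card (f ` agreement v f g) = card (agreement v f g)"
    by (intro card_image inj_on_subset[OF placement_inj_on[OF assms(1)]]) (auto simp: agreement_def)
  finally show ?thesis .
qed

lemma num_contained_placed_le:
  assumes "U \<subseteq> Kn_edges n" "v * m \<le> n"
  shows "num_contained (placed ` placements v m) U \<le> card (copies H U)"
proof -
  have "F \<in> copies H U" if "F \<in> placed ` placements v m" "F \<subseteq> U" for F
    using that placed_in_copies[OF _ assms(2)] by (auto simp: copies_subset_iff[OF assms(1)])
  then have "{F \<in> placed ` placements v m. F \<subseteq> U} \<subseteq> copies H U"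
    by (intro subsetI) (elim CollectE conjE)
  then show ?thesis
    unfolding num_contained_def
    using finite_copies finite_subset[OF assms(1) finite_Kn_edges] by (intro card_mono)
qed

context
  fixes m :: nat and p :: real
  assumes m: "0 < m" and p: "0 < p" "p \<le> 1" and \<psi>_ge_1: "1 \<le> real m ^ v * p ^ e"
begin

abbreviation \<psi> :: real where
  "\<psi> \<equiv> real m ^ v * p ^ e"

lemma power_card_placed_Un_le:
  assumes placements: "f \<in> placements v m" "g \<in> placements v m"
    and overlap: "placed f \<inter> placed g \<noteq> {}"
  shows "p ^ card (placed f \<union> placed g) \<le>
    \<psi> powr (- 1 / v) * p ^ (2 * e) * real (m ^ card (agreement v f g))"
proof -
  let ?j = "card (placed f \<inter> placed g)" and ?u = "card (placed f \<union> placed g)"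
    and ?a = "card (agreement v f g)"
  have fin: "finite (placed f)" "finite (placed g)" using finite_H by auto
  have "card (placed f) = e" "card (placed g) = e"
    using placements placed_in_copies[OF _ order_refl] card_copy by metis+
  then have card_Un: "?u + ?j = 2 * e" using card_Un_Int[OF fin] by simp
  have "0 < ?j" using overlap fin by (simp add: card_gt_0_iff)
  then have "0 < ?a" using card_placed_Int_le[OF placements] v_pos by (cases "?a = 0") auto
  then have "1 \<le> \<psi> powr (- 1 / v) * (real m ^ ?a * p ^ ?j)"
    using card_placed_Int_le[OF placements] m p \<psi>_ge_1 v_pos by (intro one_le_powr_mult_power) auto
  then have "p ^ ?u * 1 \<le> p ^ ?u * (\<psi> powr (- 1 / v) * (real m ^ ?a * p ^ ?j))"
    using p by (intro mult_left_mono) auto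
  also have "\<dots> = \<psi> powr (- 1 / v) * p ^ (?u + ?j) * real (m ^ ?a)"
    by (simp add: power_add)
  finally show ?thesis unfolding card_Un by simp
qed

lemma overlap_sum_placed_le:
  "overlap_sum p (placed ` placements v m) \<le> 2 ^ v * \<psi>\<^sup>2 * \<psi> powr (- 1 / v)"
proof -
  let ?P = "placements v m" and ?B = "\<psi> powr (- 1 / v)"
  have "overlap_sum p (placed ` ?P) =
      (\<Sum>f\<in>?P. \<Sum>g\<in>?P. if placed f \<inter> placed g \<noteq> {} then p ^ card (placed f \<union> placed g) else 0)"
    using finite_placements
    by (simp add: overlap_sum_def sum.inter_filter sum.reindex[OF inj_on_placed])
  also have "\<dots> \<le> (\<Sum>f\<in>?P. \<Sum>g\<in>?P. ?B * p ^ (2 * e) * real (m ^ card (agreement v f g)))"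
    using power_card_placed_Un_le p by (intro sum_mono) auto
  also have "\<dots> = ?B * p ^ (2 * e) * (\<Sum>f\<in>?P. real (\<Sum>g\<in>?P. m ^ card (agreement v f g)))"
    by (simp add: sum_distrib_left)
  also have "\<dots> \<le> ?B * p ^ (2 * e) * (\<Sum>f\<in>?P. real (2 ^ v * m ^ v))"
    using p sum_power_card_agreement_le by (intro mult_left_mono sum_mono of_nat_mono) auto
  also have "\<dots> = 2 ^ v * \<psi>\<^sup>2 * ?B"
    by (simp add: card_placements power_mult_distrib power2_eq_square power_add mult_2)
  finally show ?thesis .
qed

end

lemma placed_edges:
  assumes "F \<in> placed ` placements v m" "v * m \<le> n"
  shows "F \<subseteq> Kn_edges n \<and> card F = e"
proof -
  have copy: "F \<in> copies H (Kn_edges n)" using assms(1) placed_in_copies[OF _ assms(2)] by blast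
  then have "F \<subseteq> Kn_edges n" by (rule copiesE)
  then show ?thesis using card_copy[OF copy] by simp
qed

lemma expected_placed_ge:
  assumes "N \<le> n choose 2" "2 * e \<le> N"
  shows "real m ^ v * edge_density n N ^ e / 2 ^ e \<le>
    real (card (placed ` placements v m)) * containment_prob N (n choose 2) e"
proof -
  have card_placed: "real (card (placed ` placements v m)) = real m ^ v"
    by (simp add: card_image inj_on_placed card_placements)
  have "real m ^ v * edge_density n N ^ e / 2 ^ e = real m ^ v * (edge_density n N / 2) ^ e"
    by (simp add: power_divide)
  also have "\<dots> \<le> real m ^ v * containment_prob N (n choose 2) e"
    using containment_prob_ge[OF assms] by (intro mult_left_mono) (simp_all add: edge_density_def)
  finally show ?thesis unfolding card_placed .
qed

lemma prob_few_copies_le: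
  assumes num_edges: "N \<le> n choose 2" "2 * e \<le> N" and blocks: "v * m \<le> n" "0 < m"
    and \<psi>: "1 \<le> real m ^ v * edge_density n N ^ e"
      "2 ^ (e + 1) * real k \<le> real m ^ v * edge_density n N ^ e"
  shows "measure_pmf.prob (random_graph n N) {U. card (copies H U) < k} \<le>
    4 * 2 ^ v * 4 ^ e * (real m ^ v * edge_density n N ^ e) powr (- 1 / v)"
proof -
  let ?p = "edge_density n N" and ?\<F> = "placed ` placements v m"
  let ?\<psi> = "real m ^ v * ?p ^ e" and ?q = "containment_prob N (n choose 2) e"
  let ?\<mu> = "real (card ?\<F>) * ?q"
  have "?p \<noteq> 0" using \<psi>(1) e_pos by (auto simp: zero_power)
  then have p_bounds: "0 < ?p" "?p \<le> 1"
    using edge_density_nonneg[of n N] edge_density_le_1[OF num_edges(1)] by auto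
  have \<mu>_ge: "?\<psi> / 2 ^ e \<le> ?\<mu>" using num_edges by (rule expected_placed_ge)
  have \<mu>_pos: "0 < ?\<psi> / 2 ^ e" using \<psi>(1) by simp
  have "2 * real k \<le> ?\<psi> / 2 ^ e" using \<psi>(2) by (simp add: field_simps)
  have "measure_pmf.prob (random_graph n N) {U. card (copies H U) < k} \<le>
      measure_pmf.prob (random_graph n N) {U. num_contained ?\<F> U < k}"
    using num_contained_placed_le[OF _ blocks(1)]
    by (intro prob_random_nset_mono[OF finite_Kn_edges])
      (auto simp: card_Kn_edges num_edges nsets_def intro: le_less_trans)
  also have "\<dots> \<le> 4 * overlap_sum ?p ?\<F> / ?\<mu>\<^sup>2"
    using prob_num_contained_less_le[OF finite_Kn_edges, of N n ?\<F> e k]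
      num_edges(1) placed_edges[OF _ blocks(1)] finite_placements \<mu>_ge \<mu>_pos \<open>2 * real k \<le> ?\<psi> / 2 ^ e\<close>
    by (simp add: card_Kn_edges edge_density_def)
  also have "\<dots> \<le> 4 * (2 ^ v * ?\<psi>\<^sup>2 * ?\<psi> powr (- 1 / v)) / (?\<psi> / 2 ^ e)\<^sup>2"
    using overlap_sum_placed_le[OF blocks(2) p_bounds \<psi>(1)] \<mu>_ge \<mu>_pos blocks(2) p_bounds
    by (intro frac_le mult_left_mono power_mono) auto
  also have "\<dots> = 4 * 2 ^ v * 4 ^ e * ?\<psi> powr (- 1 / v)"
  proof -
    have "(2 ^ e)\<^sup>2 = (4 ^ e :: real)" by (simp add: power2_eq_square flip: power_mult_distrib)
    then show ?thesis using \<psi>(1) by (simp add: power_divide)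
  qed
  finally show ?thesis .
qed

lemma two_e_le_num_edges:
  assumes n_ge: "2 \<le> n" and expected: "real (8 * e) ^ e < real n ^ v * edge_density n N ^ e"
  shows "2 * e \<le> N"
proof (rule ccontr)
  assume "\<not> 2 * e \<le> N"
  then have N: "4 * real N \<le> real (8 * e)" by simp
  have "real n ^ v * edge_density n N ^ e \<le> real n ^ (2 * e) * (4 * real N / real n ^ 2) ^ e"
    using n_ge v_le_two_e edge_density_le[OF n_ge] edge_density_nonneg
    by (intro mult_mono power_increasing power_mono) auto
  also have "\<dots> = (4 * real N) ^ e" using n_ge by (simp add: power_divide power_mult)
  also have "\<dots> \<le> real (8 * e) ^ e" using N by (intro power_mono) auto
  finally show False using expected by simp
qed

theorem prob_few_copies_tendsto_0:
  assumes num_edges: "\<forall>\<^sub>F n in sequentially. N n \<le> n choose 2"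
    and expected: "filterlim (\<lambda>n. real n ^ v * edge_density n (N n) ^ e) at_top sequentially"
  shows "(\<lambda>n. measure_pmf.prob (random_graph n (N n)) {U. card (copies H U) < k}) \<longlonglongrightarrow> 0"
proof (rule tendsto_sandwich[OF _ _ tendsto_const])
  let ?\<psi> = "\<lambda>n. real (n div v) ^ v * edge_density n (N n) ^ e"
  have expected_placed: "filterlim ?\<psi> at_top sequentially"
    using v_pos edge_density_nonneg expected by (intro filterlim_power_div_mult_at_top) auto
  show "(\<lambda>n. 4 * 2 ^ v * 4 ^ e * ?\<psi> n powr (- 1 / v)) \<longlonglongrightarrow> 0"
    using v_pos by (intro tendsto_mult_right_zero tendsto_neg_powr expected_placed) auto
  show "\<forall>\<^sub>F n in sequentially. measure_pmf.prob (random_graph n (N n)) {U. card (copies H U) < k} \<le>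
      4 * 2 ^ v * 4 ^ e * ?\<psi> n powr (- 1 / v)"
    using num_edges filterlim_at_top_dense[THEN iffD1, OF expected, rule_format, of "real (8 * e) ^ e"]
      filterlim_at_top[THEN iffD1, OF expected_placed, rule_format, of "max 1 (2 ^ (e + 1) * real k)"]
      eventually_ge_at_top[of "max 2 v"]
  proof eventually_elim
    case (elim n)
    then have "2 * e \<le> N n" by (intro two_e_le_num_edges) auto
    then show ?case
      using elim v_pos by (intro prob_few_copies_le) (auto simp: div_greater_zero_iff)
  qed
qed simp

end

section \<open>Dense vertex sets in a random graph\<close>

lemma prob_dense_set_le:
  assumes num_edges: "N \<le> n choose 2"
  shows "measure_pmf.prob (random_graph n N) {U. \<exists>S\<in>[{0..<n}]\<^bsup>s\<^esup>. t \<le> card (induced_edges U S)} \<le>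
    real ((s choose 2) choose t) * (real n ^ s * edge_density n N ^ t)"
proof -
  let ?\<F> = "\<Union>S\<in>[{0..<n}]\<^bsup>s\<^esup>. [[S]\<^bsup>2\<^esup>]\<^bsup>t\<^esup>"
  have finite_family: "finite ?\<F>"
    by (auto simp: nsets_def intro!: finite_imp_finite_nsets finite_Collect_conjI)
  have "card ?\<F> \<le> (\<Sum>S\<in>[{0..<n}]\<^bsup>s\<^esup>. card ([[S]\<^bsup>2\<^esup>]\<^bsup>t\<^esup>))"
    by (intro card_UN_le finite_imp_finite_nsets) simp
  also have "\<dots> = (\<Sum>S\<in>[{0..<n}]\<^bsup>s\<^esup>. (s choose 2) choose t)"
    by (intro sum.cong) (auto simp: nsets_def[of _ s])
  also have "\<dots> = (n choose s) * ((s choose 2) choose t)" by simp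
  also have "\<dots> \<le> n ^ s * ((s choose 2) choose t)"
    using binomial_le_pow[of s n] by (cases "s \<le> n") (auto simp: binomial_eq_0)
  finally have card_family: "card ?\<F> \<le> n ^ s * ((s choose 2) choose t)" .
  have "measure_pmf.prob (random_graph n N) {U. \<exists>S\<in>[{0..<n}]\<^bsup>s\<^esup>. t \<le> card (induced_edges U S)} \<le>
      measure_pmf.prob (random_graph n N) {U. \<exists>F\<in>?\<F>. F \<subseteq> U}"
  proof (rule prob_random_nset_mono[OF finite_Kn_edges])
    fix U assume U: "U \<in> [Kn_edges n]\<^bsup>N\<^esup>" and "\<exists>S\<in>[{0..<n}]\<^bsup>s\<^esup>. t \<le> card (induced_edges U S)"
    then obtain S where S: "S \<in> [{0..<n}]\<^bsup>s\<^esup>" "t \<le> card (induced_edges U S)" by blast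
    obtain F where F: "F \<subseteq> induced_edges U S" "card F = t" "finite F"
      using S(2) by (rule obtain_subset_with_card_n)
    then have "F \<in> [[S]\<^bsup>2\<^esup>]\<^bsup>t\<^esup>" "F \<subseteq> U"
      using U by (auto simp: induced_edges_def Kn_edges_eq nsets_def)
    then show "\<exists>F\<in>?\<F>. F \<subseteq> U" using S(1) by blast
  qed (simp add: card_Kn_edges num_edges)
  also have "\<dots> \<le> real (card ?\<F>) * edge_density n N ^ t"
    unfolding edge_density_def card_Kn_edges[symmetric]
  proof (rule prob_random_nset_superset_Union_le[OF finite_Kn_edges _ finite_family])
    show "F \<subseteq> Kn_edges n \<and> card F = t" if "F \<in> ?\<F>" for F
      using that by (auto simp: Kn_edges_eq nsets_def)
  qed (simp add: card_Kn_edges num_edges)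
  also have "\<dots> \<le> real (n ^ s * ((s choose 2) choose t)) * edge_density n N ^ t"
    using card_family by (intro mult_right_mono of_nat_mono) (auto simp: edge_density_nonneg)
  finally show ?thesis by (simp add: mult_ac)
qed

lemma prob_dense_set_tendsto_0:
  assumes num_edges: "\<forall>\<^sub>F n in sequentially. N n \<le> n choose 2"
    and expected: "(\<lambda>n. real n ^ s * edge_density n (N n) ^ t) \<longlonglongrightarrow> 0"
  shows "(\<lambda>n. measure_pmf.prob (random_graph n (N n))
    {U. \<exists>S\<in>[{0..<n}]\<^bsup>s\<^esup>. t \<le> card (induced_edges U S)}) \<longlonglongrightarrow> 0"
proof (rule tendsto_sandwich[OF _ _ tendsto_const])
  show "(\<lambda>n. real ((s choose 2) choose t) * (real n ^ s * edge_density n (N n) ^ t)) \<longlonglongrightarrow> 0"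
    using expected by (rule tendsto_mult_right_zero)
  show "\<forall>\<^sub>F n in sequentially. measure_pmf.prob (random_graph n (N n))
      {U. \<exists>S\<in>[{0..<n}]\<^bsup>s\<^esup>. t \<le> card (induced_edges U S)} \<le>
    real ((s choose 2) choose t) * (real n ^ s * edge_density n (N n) ^ t)"
    using num_edges by eventually_elim (rule prob_dense_set_le)
qed simp

lemma not_locally_sparse_imp_dense_set:
  assumes "U \<subseteq> Kn_edges n" "\<not> locally_sparse U"
  shows "\<exists>s\<le>23. \<exists>S\<in>[{0..<n}]\<^bsup>s\<^esup>. Suc (10 * s div 7) \<le> card (induced_edges U S)"
proof -
  obtain S where S: "finite S" "card S \<le> 23" "weight U S < 0"
    using assms(2) by (auto simp: locally_sparse_def not_le)
  let ?S = "S \<inter> {0..<n}"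
  have card_le: "card ?S \<le> card S" using S(1) by (intro card_mono) auto
  have "induced_edges U S = induced_edges U ?S"
    using assms(1) by (auto simp: induced_edges_def Kn_edges_eq nsets_def)
  then have "10 * card ?S < 7 * card (induced_edges U ?S)" using S(3) card_le
    by (simp add: weight_def)
  then have "Suc (10 * card ?S div 7) \<le> card (induced_edges U ?S)" by simp
  moreover have "?S \<in> [{0..<n}]\<^bsup>card ?S\<^esup>" by (simp add: nsets_def)
  ultimately show ?thesis using S(2) card_le by (meson order_trans)
qed

lemma prob_not_locally_sparse_tendsto_0:
  assumes num_edges: "\<forall>\<^sub>F n in sequentially. N n \<le> n choose 2"
    and expected: "\<And>s t. 10 * s < 7 * t \<Longrightarrow> (\<lambda>n. real n ^ s * edge_density n (N n) ^ t) \<longlonglongrightarrow> 0"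
  shows "(\<lambda>n. measure_pmf.prob (random_graph n (N n)) {U. \<not> locally_sparse U}) \<longlonglongrightarrow> 0"
proof (rule tendsto_sandwich[OF _ _ tendsto_const])
  let ?dense = "\<lambda>n s. {U. \<exists>S\<in>[{0..<n}]\<^bsup>s\<^esup>. Suc (10 * s div 7) \<le> card (induced_edges U S)}"
  let ?P = "\<lambda>n. measure_pmf.prob (random_graph n (N n))"
  have "(\<lambda>n. \<Sum>s\<le>23. ?P n (?dense n s)) \<longlonglongrightarrow> (\<Sum>s\<le>(23::nat). 0)"
    by (intro tendsto_sum prob_dense_set_tendsto_0 num_edges expected) presburger
  then show "(\<lambda>n. \<Sum>s\<le>23. ?P n (?dense n s)) \<longlonglongrightarrow> 0" by simp
  show "\<forall>\<^sub>F n in sequentially. ?P n {U. \<not> locally_sparse U} \<le> (\<Sum>s\<le>23. ?P n (?dense n s))"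
    using num_edges
  proof eventually_elim
    case (elim n)
    have "?P n {U. \<not> locally_sparse U} \<le> ?P n {U. \<exists>s\<le>23. U \<in> ?dense n s}"
      using elim not_locally_sparse_imp_dense_set[of _ n]
      by (intro prob_random_nset_mono[OF finite_Kn_edges])
        (auto simp: card_Kn_edges nsets_def[of "Kn_edges n"])
    also have "{U. \<exists>s\<le>23. U \<in> ?dense n s} = (\<Union>s\<in>{..23}. ?dense n s)" by blast
    also have "?P n \<dots> \<le> (\<Sum>s\<le>23. ?P n (?dense n s))"
      by (intro measure_UNION_le) auto
    finally show ?case .
  qed
qed simp

section \<open>The random graph process\<close>

lemma card_permutations_prefix:
  assumes "finite A" "U \<in> [A]\<^bsup>N\<^esup>"
  shows "card {es \<in> permutations_of_set A. set (take N es) = U} = fact N * fact (card A - N)"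
proof -
  let ?E = "{es \<in> permutations_of_set A. set (take N es) = U}"
  let ?P = "permutations_of_set U \<times> permutations_of_set (A - U)"
  have U: "U \<subseteq> A" "card U = N" "finite U" using assms(2) by (auto simp: nsets_def)
  have "bij_betw (\<lambda>(xs, ys). xs @ ys) ?P ?E"
  proof (rule bij_betw_byWitness[where f' = "\<lambda>es. (take N es, drop N es)"])
    have len: "length xs = N" if "xs \<in> permutations_of_set U" for xs
      using length_finite_permutations_of_set[OF that] U(2) by simp
    then show "\<forall>a\<in>?P. (take N (case a of (xs, ys) \<Rightarrow> xs @ ys),
        drop N (case a of (xs, ys) \<Rightarrow> xs @ ys)) = a"
      by auto
    show "\<forall>es\<in>?E. (case (take N es, drop N es) of (xs, ys) \<Rightarrow> xs @ ys) = es" by auto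
    show "(\<lambda>(xs, ys). xs @ ys) ` ?P \<subseteq> ?E"
      using U len by (auto simp: permutations_of_set_def)
    show "(\<lambda>es. (take N es, drop N es)) ` ?E \<subseteq> ?P"
    proof clarify
      fix es assume es: "es \<in> permutations_of_set A" "U = set (take N es)"
      then have perm: "distinct (take N es @ drop N es)" "set (take N es @ drop N es) = A"
        by (auto simp: permutations_of_set_def)
      then have "set (drop N es) = A - set (take N es)"
        unfolding set_append distinct_append by blast
      then show "take N es \<in> permutations_of_set (set (take N es)) \<and>
          drop N es \<in> permutations_of_set (A - set (take N es))"
        using perm(1) by (auto simp: permutations_of_set_def)
    qed
  qed
  then have "card ?E = card ?P" by (rule bij_betw_same_card[symmetric])
  then show ?thesis using U assms(1) by (simp add: card_cartesian_product card_Diff_subset)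
qed

lemma set_take_permutation:
  assumes "es \<in> permutations_of_set A" "N \<le> card A"
  shows "set (take N es) \<in> [A]\<^bsup>N\<^esup>"
  using assms set_take_subset[of N es] length_finite_permutations_of_set[OF assms(1)]
  by (auto simp: nsets_def permutations_of_set_def distinct_card)

lemma map_pmf_prefix_permutation:
  assumes carrier: "finite A" "N \<le> card A"
  shows "map_pmf (\<lambda>es. set (take N es)) (pmf_of_set (permutations_of_set A)) = random_nset A N"
proof (rule pmf_eqI)
  fix U
  have perms: "permutations_of_set A \<noteq> {}" "finite (permutations_of_set A)"
    using carrier(1) by simp_all
  have "pmf (map_pmf (\<lambda>es. set (take N es)) (pmf_of_set (permutations_of_set A))) U =
      real (card {es \<in> permutations_of_set A. set (take N es) = U}) / fact (card A)"
    unfolding pmf_map measure_pmf_of_set[OF perms] using carrier(1)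
    by (simp add: Int_def vimage_def)
  also have "\<dots> = indicator ([A]\<^bsup>N\<^esup>) U / real (card A choose N)"
  proof (cases "U \<in> [A]\<^bsup>N\<^esup>")
    case True
    then show ?thesis
      using card_permutations_prefix[OF carrier(1) True] carrier(2) by (simp add: binomial_fact)
  next
    case False
    then have "{es \<in> permutations_of_set A. set (take N es) = U} = {}"
      using set_take_permutation[OF _ carrier(2)] by blast
    then show ?thesis using False by (simp only: card.empty) simp
  qed
  also have "\<dots> = pmf (random_nset A N) U"
    using carrier by (simp add: nsets_nonempty finite_imp_finite_nsets)
  finally show "pmf (map_pmf (\<lambda>es. set (take N es)) (pmf_of_set (permutations_of_set A))) U =
      pmf (random_nset A N) U" .
qed

lemma proc_prob_eq:
  "proc_prob n Q = measure_pmf.prob (pmf_of_set (permutations_of_set (Kn_edges n))) {es. Q es}"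
  using finite_Kn_edges[of n] by (simp add: proc_prob_def measure_pmf_of_set Int_def)

lemma proc_prob_ge:
  assumes num_edges: "N \<le> n choose 2"
    and implies_Q: "\<And>es. es \<in> permutations_of_set (Kn_edges n) \<Longrightarrow> R (set (take N es)) \<Longrightarrow> Q es"
  shows "1 - measure_pmf.prob (random_graph n N) {U. \<not> R U} \<le> proc_prob n Q"
proof -
  let ?\<Omega> = "pmf_of_set (permutations_of_set (Kn_edges n))"
  have "measure_pmf.prob (random_graph n N) {U. \<not> R U} =
      measure_pmf.prob ?\<Omega> {es. \<not> R (set (take N es))}"
    using num_edges
    by (simp add: card_Kn_edges vimage_def flip: map_pmf_prefix_permutation[OF finite_Kn_edges])
  also have "\<dots> = 1 - measure_pmf.prob ?\<Omega> {es. R (set (take N es))}"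
    using measure_pmf.prob_compl[of "{es. R (set (take N es))}" ?\<Omega>]
    by (simp add: Compl_eq set_diff_eq)
  finally have "measure_pmf.prob (random_graph n N) {U. \<not> R U} =
      1 - measure_pmf.prob ?\<Omega> {es. R (set (take N es))}" .
  moreover have "measure_pmf.prob ?\<Omega> {es. R (set (take N es))} \<le> proc_prob n Q"
    unfolding proc_prob_eq using implies_Q finite_Kn_edges[of n]
    by (intro measure_pmf.finite_measure_mono_AE) (auto simp: AE_measure_pmf_iff)
  ultimately show ?thesis by simp
qed

lemma hitting_time_cong:
  assumes N: "N \<le> length es" "Q (proc_graph es N)"
    and eq: "\<And>i. i \<le> N \<Longrightarrow> P (proc_graph es i) \<longleftrightarrow> Q (proc_graph es i)"
  shows "hitting_time es P = hitting_time es Q"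
proof -
  let ?l = "LEAST i. Q (proc_graph es i)"
  have least: "?l \<le> N" "Q (proc_graph es ?l)"
    using N(2) by (rule Least_le, rule LeastI)
  have "(LEAST i. P (proc_graph es i)) = ?l"
  proof (rule Least_equality)
    show "P (proc_graph es ?l)" using eq least by blast
    show "?l \<le> i" if "P (proc_graph es i)" for i
      using eq[of i] that least(1) Least_le[of "\<lambda>i. Q (proc_graph es i)" i] by linarith
  qed
  then show ?thesis using N eq[of N] unfolding hitting_time_def by auto
qed

lemma hitting_times_eq:
  assumes permutation: "es \<in> permutations_of_set (Kn_edges n)" and num_edges: "N \<le> n choose 2"
    and "0 < n"
    and good: "locally_sparse (set (take N es))" "has_k_DD 2 (set (take N es))"
  shows "hitting_time es (maker_first_win n) = hitting_time es (has_k_DD 1)"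
    and "hitting_time es (maker_second_win n) = hitting_time es (has_k_DD 2)"
proof -
  have len: "N \<le> length es"
    using length_finite_permutations_of_set[OF permutation] num_edges by (simp add: card_Kn_edges)
  have prefixes: "proc_graph es i \<subseteq> Kn_edges n" "locally_sparse (proc_graph es i)" if "i \<le> N" for i
    using permutation set_take_subset[of i es]
      locally_sparse_subset[OF good(1) set_take_subset_set_take[OF that]]
    by (auto simp: proc_graph_def permutations_of_set_def)
  have "has_k_DD 1 (proc_graph es N)" "has_k_DD 2 (proc_graph es N)"
    using good(2) by (simp_all add: proc_graph_def has_k_DD_def)
  then show "hitting_time es (maker_first_win n) = hitting_time es (has_k_DD 1)"
    and "hitting_time es (maker_second_win n) = hitting_time es (has_k_DD 2)"
    using len prefixes \<open>0 < n\<close>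
    by (auto intro!: hitting_time_cong[of N] simp: maker_first_win_iff maker_second_win_iff)
qed

text \<open>The threshold of the double diamond is \<open>n powr (13/10)\<close>; the logarithm carries the process
  just past it, while every denser graph is still absent.\<close>
definition horizon :: "nat \<Rightarrow> nat" where
  "horizon n = nat \<lceil>real n powr (13/10) * ln (real n)\<rceil>"

lemma horizon_le: "\<forall>\<^sub>F n in sequentially. horizon n \<le> n choose 2"
proof -
  have "\<forall>\<^sub>F n::nat in sequentially. real n powr (13/10) * ln (real n) + 1 \<le> real n * (real n - 1) / 2"
    by real_asymp
  then show ?thesis
  proof eventually_elim
    case (elim n)
    have "real (horizon n) \<le> real n powr (13/10) * ln (real n) + 1"
    proof -
      have "0 \<le> real n powr (13/10) * ln (real n)" by (cases "n = 0") auto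
      then show ?thesis unfolding horizon_def by linarith
    qed
    also have "\<dots> \<le> real (n choose 2)" using elim by (simp add: real_choose_two)
    finally show ?case by simp
  qed
qed

lemma edge_density_horizon:
  "(\<lambda>n. edge_density n (horizon n) * real n powr (7/10) / ln (real n)) \<longlonglongrightarrow> 2"
  unfolding edge_density_def horizon_def real_choose_two by real_asymp

lemma DD_expectation_at_top:
  "filterlim (\<lambda>n. real n ^ 7 * edge_density n (horizon n) ^ 10) at_top sequentially"
  unfolding edge_density_def horizon_def real_choose_two by real_asymp

lemma power_le_powr_power:
  fixes x :: real
  assumes "10 * s < 7 * t" "1 < x"
  shows "x ^ s \<le> (x powr (7/10)) ^ t * x powr (- (1/10))"
proof -
  have "real (10 * s + 1) \<le> real (7 * t)" using assms(1) by (intro of_nat_mono) simp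
  then have "x powr real s \<le> x powr (7/10 * real t + - (1/10))"
    using assms(2) by (intro powr_mono) auto
  also have "\<dots> = x powr (7/10 * real t) * x powr (- (1/10))" by (rule powr_add)
  also have "x powr (7/10 * real t) = (x powr (7/10)) ^ t"
    using assms(2) by (simp add: powr_power mult.commute)
  finally show ?thesis using assms(2) by (simp add: powr_realpow)
qed

lemma denser_expectation_tendsto_0:
  assumes denser: "10 * s < 7 * t"
  shows "(\<lambda>n. real n ^ s * edge_density n (horizon n) ^ t) \<longlonglongrightarrow> 0"
proof -
  let ?p = "\<lambda>n. edge_density n (horizon n)"
  let ?c = "\<lambda>n. ?p n * real n powr (7/10) / ln (real n)"
  have "(\<lambda>n::nat. ln (real n) ^ t * real n powr (- (1/10))) \<longlonglongrightarrow> 0" by real_asymp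
  then have "(\<lambda>n. ?c n ^ t * (ln (real n) ^ t * real n powr (- (1/10)))) \<longlonglongrightarrow> 2 ^ t * 0"
    using edge_density_horizon by (intro tendsto_intros)
  then have bound: "(\<lambda>n. ?c n ^ t * (ln (real n) ^ t * real n powr (- (1/10)))) \<longlonglongrightarrow> 0" by simp
  show ?thesis
  proof (rule tendsto_sandwich[OF _ _ tendsto_const bound])
    show "\<forall>\<^sub>F n in sequentially. 0 \<le> real n ^ s * ?p n ^ t"
      by (simp add: edge_density_nonneg)
    show "\<forall>\<^sub>F n in sequentially. real n ^ s * ?p n ^ t \<le>
        ?c n ^ t * (ln (real n) ^ t * real n powr (- (1/10)))"
      using eventually_gt_at_top[of 1]
    proof eventually_elim
      case (elim n)
      have "real n ^ s * ?p n ^ t \<le> (real n powr (7/10)) ^ t * real n powr (- (1/10)) * ?p n ^ t"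
        using elim
        by (intro mult_right_mono power_le_powr_power denser) (simp_all add: edge_density_nonneg)
      also have "\<dots> = ?c n ^ t * (ln (real n) ^ t * real n powr (- (1/10)))"
        using elim by (simp add: power_divide power_mult_distrib)
      finally show ?case .
    qed
  qed
qed

interpretation DD: balanced_pattern DD_edges 7
proof
  show "DD_edges \<subseteq> [{0..<7}]\<^bsup>2\<^esup>" by (auto simp: DD_edges_def)
  have "{} \<notin> DD_edges" by (simp add: DD_edges_def)
  then show "balanced DD_edges" using DD_strictly_balanced by (intro strictly_balanced_imp_balanced)
qed (simp_all add: Union_DD_edges)

lemma proc_prob_tendsto_1:
  assumes implies_Q: "\<And>n es N. es \<in> permutations_of_set (Kn_edges n) \<Longrightarrow> N \<le> n choose 2 \<Longrightarrow> 0 < n \<Longrightarrow>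
    locally_sparse (set (take N es)) \<Longrightarrow> has_k_DD 2 (set (take N es)) \<Longrightarrow> Q n es"
  shows "(\<lambda>n. proc_prob n (Q n)) \<longlonglongrightarrow> 1"
proof -
  let ?P = "\<lambda>n. measure_pmf.prob (random_graph n (horizon n))"
  have "(\<lambda>n. ?P n {U. \<not> locally_sparse U}) \<longlonglongrightarrow> 0"
    using horizon_le denser_expectation_tendsto_0 by (rule prob_not_locally_sparse_tendsto_0)
  moreover have "(\<lambda>n. ?P n {U. \<not> has_k_DD 2 U}) \<longlonglongrightarrow> 0"
    using DD.prob_few_copies_tendsto_0[OF horizon_le, of 2] DD_expectation_at_top
    by (simp add: has_k_DD_def DD_copies_eq card_DD_edges not_le)
  ultimately have "(\<lambda>n. 1 - (?P n {U. \<not> locally_sparse U} + ?P n {U. \<not> has_k_DD 2 U})) \<longlonglongrightarrow> 1 - (0 + 0)"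
    by (intro tendsto_intros)
  then have lower: "(\<lambda>n. 1 - (?P n {U. \<not> locally_sparse U} + ?P n {U. \<not> has_k_DD 2 U})) \<longlonglongrightarrow> 1" by simp
  show ?thesis
  proof (rule tendsto_sandwich[OF _ _ lower tendsto_const])
    show "\<forall>\<^sub>F n in sequentially. proc_prob n (Q n) \<le> 1" by (simp add: proc_prob_eq)
    show "\<forall>\<^sub>F n in sequentially.
        1 - (?P n {U. \<not> locally_sparse U} + ?P n {U. \<not> has_k_DD 2 U}) \<le> proc_prob n (Q n)"
      using horizon_le eventually_gt_at_top[of 0]
    proof eventually_elim
      case (elim n)
      have "{U. \<not> (locally_sparse U \<and> has_k_DD 2 U)} = {U. \<not> locally_sparse U} \<union> {U. \<not> has_k_DD 2 U}"
        by blast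
      then have "?P n {U. \<not> (locally_sparse U \<and> has_k_DD 2 U)} \<le>
          ?P n {U. \<not> locally_sparse U} + ?P n {U. \<not> has_k_DD 2 U}"
        by (simp only:) (rule measure_Un_le, simp_all)
      moreover have "1 - ?P n {U. \<not> (locally_sparse U \<and> has_k_DD 2 U)} \<le> proc_prob n (Q n)"
        using elim(1) by (rule proc_prob_ge) (use implies_Q elim in blast)
      ultimately show ?case by linarith
    qed
  qed
qed

theorem theorem4:
  shows "((\<lambda>n. proc_prob n (\<lambda>es. hitting_time es (maker_first_win n) = hitting_time es (has_k_DD 1)))
           \<longlonglongrightarrow> 1) \<and>
         ((\<lambda>n. proc_prob n (\<lambda>es. hitting_time es (maker_second_win n) = hitting_time es (has_k_DD 2)))
           \<longlonglongrightarrow> 1)"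
  by (intro conjI proc_prob_tendsto_1 hitting_times_eq)

end
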